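(* Let $T>0$ and let $\lambda,G,F,\beta,r_0$ be as in the context. Then there exists a unique solution to the discontinuous Volterra system $$\rho_t=\min\{r_0,1\}\bar F(t)+\int_0^t\mathbb 1_{\{\rho_{u-}<1\}}\bar G(t-u)\lambda(u)du+\int_0^t\mathbb 1_{\{\eta_{u-}>0\}}\bar G(t-u)d(u)du,$$ $$\eta_t=\max\{r_0-1,0\}+\int_0^t\mathbb 1_{\{\rho_{u-}=1\}}\mathbb 1_{\{\eta_{u-}<\beta\}}\lambda(u)du-\int_0^t\mathbb 1_{\{\eta_{u-}>0\}}d(u)du,$$ $$D_t=\min\{r_0,1\}F(t)+\int_0^t\mathbb 1_{\{\rho_{u-}<1\}}G(t-u)\lambda(u)du+\int_0^t\mathbb 1_{\{\eta_{u-}>0\}}G(t-u)d(u)du,$$ where $D_t=\int_0^td(u)du$. That is, there exists a unique solution $(\rho,\eta,d)$ such that for $t\in[0,T]$ $$\rho_t=\min\{r_0,1\}\bar F(t)+\int_0^t z^1(u)\bar G(t-u)\lambda(u)du+\int_0^t z^2(u)\bar G(t-u)d(u)du,$$ $$\eta_t=\max\{r_0-1,0\}+\int_0^t(1-z^1(u))z^3(u)\lambda(u)du-\int_0^tz^2(u)d(u)du,$$ $$D_t=\min\{r_0,1\}F(t)+\int_0^tz^1(u)G(t-u)\lambda(u)du+\int_0^tz^2(u)G(t-u)d(u)du,$$ for some $(z^1,z^2,z^3)$ that satisfies, for almost every $t\in[0,T]$, $$\mathbb 1_{\{\rho_t<1\}}\le z^1(t)\le1,\qquad \mathbb 1_{\{\eta_t>0\}}\le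 z^2(t)\le1,\qquad \mathbb 1_{\{\eta_t<\beta\}}\le z^3(t)\le1,$$ and $$0\le\rho_t\le1,\qquad 0\le\eta_t\le\beta,\qquad \eta_t(1-\rho_t)=0.$$
   Context: The data come from a sequence of $M_t/G/n/(n+b_n)$ queues: nonhomogeneous Poisson arrivals with intensity function $n\lambda(\cdot)$, where $\lambda$ is locally integrable; service times sampled independently from a distribution $G$ with density $g$ bounded by a constant $c_g>0$; $n$ servers and $b_n$ buffer spaces with $b_n/n\to\beta\in[0,\infty)$; arrivals finding the system full are lost. The number $N_0^n$ of customers in the system at time $0$ satisfies $|N_0^n/n-r_0|\to0$ almost surely, with $r_0\in(0,1+\beta]$, and the empirical distribution $F^n$ of the remaining service times of the initially occupied servers satisfies $\sup_t|F^n(t)-F(t)|\to0$ almost surely for some distribution $F$. Write $\bar G=1-G$, $\bar F=1-F$. The function $d$ is the fluid departure rate, i.e. the density of $D$.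
   Formalization: The formal theorem also assumes that F has an integrable density on [0,T]; this is necessary, since D_t is the integral of d and G has a bounded density, so for example if F has an atom in [0,T] no solution exists. *)

theory Defs
  imports "HOL-Probability.Probability"
begin

text \<open>
  \<open>G\<close> and \<open>F\<close> are probability measures on the real line, and \<open>cdf G\<close>, \<open>cdf F\<close> their
  distribution functions. The unknowns are functions on the whole line of which only the
  restriction to \<open>{0..T}\<close> matters; \<open>d\<close> is an integrable density, so it is meaningful only up to
  null sets. Boundedness of the measurable selectors \<open>z\<^sub>1, z\<^sub>2, z\<^sub>3\<close> (almost everywhere on
  \<open>{0..T}\<close>) makes every integrand below integrable as soon as \<open>lam\<close> is integrable on \<open>{0..T}\<close>,
  so no integral takes its default value. The left-hand side of the third equation is the
  cumulative departure process at time \<open>t\<close>.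
\<close>

definition fluid_solution ::
  "real \<Rightarrow> (real \<Rightarrow> real) \<Rightarrow> real measure \<Rightarrow> real measure \<Rightarrow> real \<Rightarrow> real \<Rightarrow>
   (real \<Rightarrow> real) \<Rightarrow> (real \<Rightarrow> real) \<Rightarrow> (real \<Rightarrow> real) \<Rightarrow> bool" where
  "fluid_solution T lam G F \<beta> r0 \<rho> \<eta> d \<longleftrightarrow>
     set_integrable lborel {0..T} d \<and>
     (\<exists>z\<^sub>1 z\<^sub>2 z\<^sub>3 :: real \<Rightarrow> real.
        set_borel_measurable lborel {0..T} z\<^sub>1 \<and>
        set_borel_measurable lborel {0..T} z\<^sub>2 \<and>
        set_borel_measurable lborel {0..T} z\<^sub>3 \<and>
        (\<forall>t\<in>{0..T}.
           \<rho> t = min r0 1 * (1 - cdf F t)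
             + (LINT u:{0..t}|lborel. z\<^sub>1 u * (1 - cdf G (t - u)) * lam u)
             + (LINT u:{0..t}|lborel. z\<^sub>2 u * (1 - cdf G (t - u)) * d u)) \<and>
        (\<forall>t\<in>{0..T}.
           \<eta> t = max (r0 - 1) 0
             + (LINT u:{0..t}|lborel. (1 - z\<^sub>1 u) * z\<^sub>3 u * lam u)
             - (LINT u:{0..t}|lborel. z\<^sub>2 u * d u)) \<and>
        (\<forall>t\<in>{0..T}.
           (LINT u:{0..t}|lborel. d u) = min r0 1 * cdf F t
             + (LINT u:{0..t}|lborel. z\<^sub>1 u * cdf G (t - u) * lam u)
             + (LINT u:{0..t}|lborel. z\<^sub>2 u * cdf G (t - u) * d u)) \<and>
        (AE t\<in>{0..T} in lborel.
           of_bool (\<rho> t < 1) \<le> z\<^sub>1 t \<and> z\<^sub>1 t \<le> 1 \<and>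
           of_bool (\<eta> t > 0) \<le> z\<^sub>2 t \<and> z\<^sub>2 t \<le> 1 \<and>
           of_bool (\<eta> t < \<beta>) \<le> z\<^sub>3 t \<and> z\<^sub>3 t \<le> 1 \<and>
           0 \<le> \<rho> t \<and> \<rho> t \<le> 1 \<and>
           0 \<le> \<eta> t \<and> \<eta> t \<le> \<beta> \<and>
           \<eta> t * (1 - \<rho> t) = 0))"

end

theory Submission imports Defs begin

text \<open>
  The total content \<open>x = \<rho> + \<eta>\<close> determines \<open>\<rho> = min x 1\<close> and \<open>\<eta> = max (x - 1) 0\<close>. The losses
  \<open>\<integral>(1 - z\<^sub>1)(1 - z\<^sub>3) lam\<close> increase only while \<open>x = 1 + \<beta>\<close>, so \<open>x\<close> is the one-sided Skorokhod
  reflection at \<open>1 + \<beta>\<close> of \<open>r0 + \<integral>lam - D\<close>, hence a Lipschitz functional of \<open>D\<close>. So is the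
  cumulative input to service \<open>A = min x 1 - min r0 1 + D\<close>. After integration by parts the departure
  equation reads \<open>D = min r0 1 * F + g * A\<close>. Because \<open>g\<close> is bounded, its right-hand side is a
  contraction of \<open>D\<close> in an exponentially weighted supremum norm, which gives uniqueness and a
  candidate \<open>D\<close>. The Picard iterates are nondecreasing; thus so is \<open>D\<close>, its increments are dominated
  by those of an integral, and it has a density \<open>d\<close>; likewise for the losses. The
  chain rule for \<open>min x 1\<close> then shows that \<open>A\<close> has density \<open>lam\<close> on \<open>{x < 1}\<close> and \<open>d\<close> on \<open>{x \<ge> 1}\<close>.
\<close>

section \<open>Indefinite integrals and densities\<close>

text \<open>The selectors \<open>z\<^sub>1, z\<^sub>2, z\<^sub>3\<close> are not unique and jump
  with the state, so the equations for \<open>\<rho>\<close>, \<open>\<eta>\<close>,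
  \<open>d\<close> offer no continuous map to iterate. Hence the passage to \<open>D\<close>, which
  the selectors enter only through integrals. The unknown density inside the departure equation
  would not be controlled by a supremum bound on \<open>D\<close>; after integration by parts the
  kernel is \<open>g\<close> and the integrand is the cumulative input \<open>A\<close>, which is
  controlled.

  \<open>fluid_solution\<close> puts no sign on \<open>d\<close>. Uniqueness is therefore proved
  among continuous \<open>D\<close>, while monotonicity serves existence, where densities have to be
  recovered from \<open>D\<close> and from the losses.

  A density of \<open>F\<close> is forced by the problem: the convolution of \<open>g\<close> with
  \<open>A\<close> is Lipschitz and \<open>min r0 1 > 0\<close>, so \<open>D\<close> can be an
  indefinite integral only if \<open>F\<close> is one on \<open>{0..T}\<close>.

  Lebesgue points are avoided throughout. Signs and equalities of densities are read off from
  primitives by comparing finite measures on half-lines, and local estimates are made global by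
  bisection (\<open>Bolzano\<close>).\<close>

definition cumul :: "(real \<Rightarrow> real) \<Rightarrow> real \<Rightarrow> real" where
  "cumul a t = (LINT u:{0..t}|lborel. a u)"

lemma set_integrable_Icc_subset:
  fixes a :: "real \<Rightarrow> real"
  assumes "set_integrable lborel {0..T} a" "S \<in> sets borel" "S \<subseteq> {0..T}"
  shows "set_integrable lborel S a"
  using assms by (intro set_integrable_subset[OF assms(1)]) auto

lemma cumul_0 [simp]: "cumul a 0 = 0"
proof -
  have "(\<lambda>u. indicat_real {0..0} u *\<^sub>R a u) = (\<lambda>u. indicat_real {0} u *\<^sub>R a 0)"
    by (auto simp: indicator_def)
  then show ?thesis unfolding cumul_def set_lebesgue_integral_def by simp
qed

lemma cumul_diff:
  assumes a: "set_integrable lborel {0..T} a" and "0 \<le> s" "s \<le> t" "t \<le> T"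
  shows "cumul a t - cumul a s = (LINT u:{s<..t}|lborel. a u)"
proof -
  have eq: "{0..t} = {0..s} \<union> {s<..t}" using assms by auto
  have "cumul a t = cumul a s + (LINT u:{s<..t}|lborel. a u)"
    unfolding cumul_def eq
    using assms by (intro set_integral_Un) (auto intro!: set_integrable_Icc_subset[OF a])
  then show ?thesis by simp
qed

lemma continuous_on_cumul:
  assumes "set_integrable lborel {0..T} a"
  shows "continuous_on {0..T} (cumul a)"
proof -
  have "continuous_on {0..T} (\<lambda>x. integral {0..x} a)"
    by (intro indefinite_integral_continuous_1 set_borel_integral_eq_integral(1) assms)
  also have "?this \<longleftrightarrow> ?thesis"
    unfolding cumul_def
    by (intro continuous_on_cong refl)
       (use set_borel_integral_eq_integral(2)[OF set_integrable_Icc_subset[OF assms]] in auto)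
  finally show ?thesis .
qed

lemma cumul_mono:
  assumes a: "set_integrable lborel {0..T} a" and nn: "AE u\<in>{0..T} in lborel. 0 \<le> a u"
    and "0 \<le> s" "s \<le> t" "t \<le> T"
  shows "cumul a s \<le> cumul a t"
proof -
  have "0 \<le> (LINT u:{s<..t}|lborel. a u)"
    unfolding set_lebesgue_integral_def
    by (rule integral_nonneg_AE) (use nn in eventually_elim, use assms in \<open>auto simp: indicator_def\<close>)
  with cumul_diff[OF a assms(3-5)] show ?thesis by simp
qed

lemma cumul_cong_AE:
  assumes "set_integrable lborel {0..T} a" "set_integrable lborel {0..T} b"
    and "AE u\<in>{0..T} in lborel. a u = b u" and "t \<le> T"
  shows "cumul a t = cumul b t"
proof -
  have m: "set_integrable lborel {0..t} a" "set_integrable lborel {0..t} b"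
    using assms by (auto intro: set_integrable_Icc_subset[of T])
  show ?thesis
    unfolding cumul_def set_lebesgue_integral_def
  proof (rule integral_cong_AE)
    show "AE x in lborel. indicat_real {0..t} x *\<^sub>R a x = indicat_real {0..t} x *\<^sub>R b x"
      using assms(3) by eventually_elim (use assms(4) in \<open>auto simp: indicator_def\<close>)
  qed (use m in \<open>auto simp: set_integrable_def\<close>)
qed

lemma cumul_add:
  assumes "set_integrable lborel {0..T} a" "set_integrable lborel {0..T} b" "t \<le> T"
  shows "cumul (\<lambda>u. a u + b u) t = cumul a t + cumul b t"
  unfolding cumul_def
  using assms by (intro set_integral_add) (auto intro: set_integrable_Icc_subset[of T])

lemma cumul_diff_fun:
  assumes "set_integrable lborel {0..T} a" "set_integrable lborel {0..T} b" "t \<le> T"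
  shows "cumul (\<lambda>u. a u - b u) t = cumul a t - cumul b t"
  unfolding cumul_def
  using assms by (intro set_integral_diff) (auto intro: set_integrable_Icc_subset[of T])

lemma cumul_cmult: "cumul (\<lambda>u. c * a u) t = c * cumul a t"
  unfolding cumul_def by simp

text \<open>Half-lines are stable under intersection and generate the Borel sets, so a Dynkin
  argument applies. The additive form expresses a difference of two measures without signed
  measures.\<close>

lemma measure_add_eqI:
  assumes fb: "finite_borel_measure M1" "finite_borel_measure M2" "finite_borel_measure M3"
    and cdf: "\<And>x. cdf M1 x + cdf M2 x = cdf M3 x"
    and A: "A \<in> sets borel"
  shows "measure M1 A + measure M2 A = measure M3 A"
proof -
  interpret M1: finite_borel_measure M1 by fact
  interpret M2: finite_borel_measure M2 by fact
  interpret M3: finite_borel_measure M3 by fact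
  have sets: "sets M1 = sets borel" "sets M2 = sets borel" "sets M3 = sets borel"
    using M1.M_is_borel M2.M_is_borel M3.M_is_borel by auto
  have sp: "space M1 = UNIV" "space M2 = UNIV" "space M3 = UNIV"
    using M1.borel_UNIV M2.borel_UNIV M3.borel_UNIV by auto
  \<comment> \<open>The complement step needs the total masses. \<open>UNIV\<close> is not a
    half-line, so they are obtained as limits of the distribution functions.\<close>
  have tot: "measure M1 UNIV + measure M2 UNIV = measure M3 UNIV"
  proof (rule LIMSEQ_unique)
    show "(\<lambda>n. cdf M1 (real n) + cdf M2 (real n)) \<longlonglongrightarrow> measure M1 UNIV + measure M2 UNIV"
      using tendsto_add[OF M1.cdf_lim_infty M2.cdf_lim_infty] by (simp add: sp)
    show "(\<lambda>n. cdf M1 (real n) + cdf M2 (real n)) \<longlonglongrightarrow> measure M3 UNIV"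
      using M3.cdf_lim_infty by (simp add: sp cdf)
  qed
  have bs: "sets borel = sigma_sets UNIV (range (\<lambda>x::real. {..x}))"
    by (subst borel_eq_atMost) simp
  have "Int_stable (range (\<lambda>x::real. {..x}))" "range (\<lambda>x::real. {..x}) \<subseteq> Pow UNIV"
    "A \<in> sigma_sets UNIV (range (\<lambda>x::real. {..x}))"
    using A bs by (auto simp: Int_stable_def)
  then show ?thesis
  proof (induction rule: sigma_sets_induct_disjoint)
    case (basic A) then show ?case using cdf by (auto simp: cdf_def)
  next
    case empty then show ?case by simp
  next
    case (compl A)
    then have "A \<in> sets borel" using bs by simp
    then have "measure M (UNIV - A) = measure M UNIV - measure M A"
      if "finite_measure M" "sets M = sets borel" "space M = UNIV" for M :: "real measure"
      using finite_measure.finite_measure_compl[OF that(1)] that by auto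
    then show ?case using compl.IH tot sets sp
      by (simp add: M1.finite_measure_axioms M2.finite_measure_axioms M3.finite_measure_axioms)
  next
    case (union A)
    have r: "range A \<subseteq> sets borel" using union(2) bs by simp
    have "(\<lambda>i. measure M1 (A i) + measure M2 (A i)) sums (measure M1 (\<Union>i. A i) + measure M2 (\<Union>i. A i))"
      using r union(1) sets by (intro sums_add M1.finite_measure_UNION M2.finite_measure_UNION) auto
    moreover have "(\<lambda>i. measure M3 (A i)) sums (measure M3 (\<Union>i. A i))"
      using r union(1) sets by (intro M3.finite_measure_UNION) auto
    ultimately show ?case using union(3) sums_unique2 by simp
  qed
qed

lemma cdf_density_set:
  assumes h: "set_integrable lborel {0..T} h" and nn: "\<And>u. 0 \<le> h u" and T: "0 \<le> T"
  defines "M \<equiv> density lborel (\<lambda>u. ennreal (indicator {0..T} u * h u))"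
  shows "finite_borel_measure M" "cdf M x = cumul h (max 0 (min T x))"
proof -
  have i: "integrable lborel (\<lambda>u. indicator {0..T} u * h u)"
    using h by (simp add: set_integrable_def)
  then have m: "(\<lambda>u. indicator {0..T} u * h u) \<in> borel_measurable borel" by auto
  have em: "emeasure M A = ennreal (LINT u|lborel. indicator A u * (indicator {0..T} u * h u))"
    if A: "A \<in> sets borel" for A
  proof -
    have "emeasure M A = (\<integral>\<^sup>+u. ennreal (indicator {0..T} u * h u) * indicator A u \<partial>lborel)"
      unfolding M_def using A m by (subst emeasure_density) auto
    also have "\<dots> = (\<integral>\<^sup>+u. ennreal (indicator A u * (indicator {0..T} u * h u)) \<partial>lborel)"
      by (intro nn_integral_cong) (auto simp: indicator_def)
    also have "\<dots> = ennreal (LINT u|lborel. indicator A u * (indicator {0..T} u * h u))"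
      using i A nn by (intro nn_integral_eq_integral) 
        (use integrable_mult_indicator[OF _ i, of A] in auto)
    finally show ?thesis .
  qed
  have "finite_measure M"
    by (rule finite_measureI) (use em[of UNIV] in \<open>simp add: M_def\<close>)
  then show "finite_borel_measure M"
    by (simp add: finite_borel_measure_def finite_borel_measure_axioms_def M_def)
  have "cdf M x = (LINT u|lborel. indicator {..x} u * (indicator {0..T} u * h u))"
    unfolding cdf_def measure_def using em[of "{..x}"] nn by (auto intro!: integral_nonneg_AE)
  also have "\<dots> = cumul h (max 0 (min T x))"
  proof (cases "x < 0")
    case True
    then have "(\<lambda>u. indicator {..x} u * (indicator {0..T} u * h u)) = (\<lambda>_. 0)"
      by (auto simp: indicator_def)
    with True T show ?thesis by simp
  next
    case False
    with T show ?thesis unfolding cumul_def set_lebesgue_integral_def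
      by (intro Bochner_Integration.integral_cong) (auto simp: indicator_def)
  qed
  finally show "cdf M x = cumul h (max 0 (min T x))" .
qed

text \<open>Clamping the argument to \<open>{0..T}\<close> extends \<open>H\<close> to a continuous
  nondecreasing function on the line that is 0 on the left and \<open>H T\<close> on the right, as a
  finite Stieltjes measure requires.\<close>

lemma cdf_interval_measure_clamp:
  assumes cont: "continuous_on {0..T} H" and mono: "mono_on {0..T} H" and H0: "H 0 = 0" and T: "0 \<le> T"
  defines "M \<equiv> interval_measure (\<lambda>x. H (max 0 (min T x)))"
  shows "finite_borel_measure M" "cdf M x = H (max 0 (min T x))"
proof -
  let ?H = "\<lambda>x. H (max 0 (min T x))"
  have 1: "?H x \<le> ?H y" if "x \<le> y" for x y
    using that T by (intro mono_onD[OF mono]) auto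
  have "continuous_on UNIV ?H"
    using T by (intro continuous_on_compose2[OF cont]) (auto intro!: continuous_intros)
  then have 2: "continuous (at_right a) ?H" for a
    by (auto simp: continuous_on_eq_continuous_at intro: continuous_at_imp_continuous_at_within)
  have 3: "(?H \<longlongrightarrow> 0) at_bot"
    by (rule tendsto_eventually) (use T H0 in \<open>auto simp: eventually_at_bot_linorder intro!: exI[of _ 0]\<close>)
  have 4: "(?H \<longlongrightarrow> H T) at_top"
    by (rule tendsto_eventually) (use T in \<open>auto simp: eventually_at_top_linorder max_def min_def intro!: exI[of _ T]\<close>)
  have 5: "0 \<le> H T" using mono_onD[OF mono, of 0 T] T H0 by simp
  show "finite_borel_measure M" "cdf M x = H (max 0 (min T x))"
    unfolding M_def using finite_borel_measure_interval_measure[OF 1 2 3 4 5]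
      cdf_interval_measure[OF 1 2 3] by auto
qed

lemma set_integrable_pos_part:
  fixes h :: "real \<Rightarrow> real"
  assumes "set_integrable M S h"
  shows "set_integrable M S (\<lambda>u. max 0 (h u))"
proof -
  have "(\<lambda>u. indicator S u *\<^sub>R max 0 (h u)) = (\<lambda>u. max 0 (indicator S u *\<^sub>R h u))"
    by (auto simp: indicator_def)
  with assms show ?thesis unfolding set_integrable_def by simp
qed

text \<open>The measure with density \<open>max 0 (- h)\<close> and the Stieltjes measure of \<open>cumul h\<close> add up to the
  measure with density \<open>max 0 h\<close>.\<close>

lemma AE_nonneg_of_cumul_mono:
  assumes h: "set_integrable lborel {0..T} h" and T: "0 \<le> T" and mono: "mono_on {0..T} (cumul h)"
  shows "AE u\<in>{0..T} in lborel. 0 \<le> h u"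
proof -
  let ?p = "\<lambda>u. max 0 (h u)" and ?n = "\<lambda>u. max 0 (- h u)"
  define P where "P = density lborel (\<lambda>u. ennreal (indicator {0..T} u * ?p u))"
  define N where "N = density lborel (\<lambda>u. ennreal (indicator {0..T} u * ?n u))"
  define K where "K = interval_measure (\<lambda>x. cumul h (max 0 (min T x)))"
  have hi: "integrable lborel (\<lambda>u. indicator {0..T} u * h u)"
    using h by (simp add: set_integrable_def)
  have p: "set_integrable lborel {0..T} ?p"
    by (rule set_integrable_pos_part) (rule h)
  have n: "set_integrable lborel {0..T} ?n"
    by (rule set_integrable_pos_part) (use h in \<open>simp add: set_integrable_def\<close>)
  note P = cdf_density_set[OF p _ T, folded P_def, simplified]
  note N = cdf_density_set[OF n _ T, folded N_def, simplified]
  note K = cdf_interval_measure_clamp[OF continuous_on_cumul[OF h] mono _ T, folded K_def, simplified]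
  have "cdf N x + cdf K x = cdf P x" for x
  proof -
    let ?x = "max 0 (min T x)"
    have x: "?x \<le> T" using T by auto
    have "cumul (\<lambda>u. ?p u - ?n u) ?x = cumul ?p ?x - cumul ?n ?x"
      by (rule cumul_diff_fun[OF p n x])
    also have "(\<lambda>u. ?p u - ?n u) = h" by (auto simp: max_def)
    finally show ?thesis by (simp add: P N K)
  qed
  note add = measure_add_eqI[OF N(1) K(1) P(1) this]
  \<comment> \<open>On \<open>E\<close> the positive part vanishes, so \<open>P\<close> gives it
    mass 0. Additivity of nonnegative masses then gives \<open>N\<close> mass 0 on \<open>E\<close>,
    where its density is strictly positive; hence \<open>E\<close> is a null set.\<close>
  define E where "E = {u. indicator {0..T} u * h u < 0}"
  have m: "(\<lambda>u. indicator {0..T} u * h u) \<in> borel_measurable borel"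
    using hi by auto
  have E: "E \<in> sets borel" unfolding E_def using m by measurable
  have mn: "(\<lambda>u. indicator {0..T} u * ?n u) \<in> borel_measurable borel"
    and mp: "(\<lambda>u. indicator {0..T} u * ?p u) \<in> borel_measurable borel"
    using n p by (auto simp: set_integrable_def)
  have "emeasure P E = (\<integral>\<^sup>+u. ennreal (indicator {0..T} u * ?p u) * indicator E u \<partial>lborel)"
    unfolding P_def using E mp by (subst emeasure_density) auto
  also have "\<dots> = (\<integral>\<^sup>+u. 0 \<partial>(lborel :: real measure))"
    by (intro nn_integral_cong) (auto simp: E_def indicator_def split: if_splits)
  finally have "measure P E = 0" by (simp add: measure_def)
  with add[OF E] have "measure N E = 0"
    by (metis add_nonneg_eq_0_iff measure_nonneg)
  moreover have "finite_measure N"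
    using N(1) by (simp add: finite_borel_measure_def)
  ultimately have "emeasure N E = 0"
    by (simp add: finite_measure.emeasure_eq_measure)
  then have "(\<integral>\<^sup>+u. ennreal (indicator {0..T} u * ?n u) * indicator E u \<partial>lborel) = 0"
    unfolding N_def using E mn by (subst (asm) emeasure_density) auto
  then have "AE u in lborel. ennreal (indicator {0..T} u * ?n u) * indicator E u = 0"
    using E mn by (subst (asm) nn_integral_0_iff_AE) auto
  then show ?thesis
    by eventually_elim (auto simp: E_def indicator_def ennreal_eq_0_iff split: if_splits)
qed

lemma AE_eq_of_cumul_eq:
  assumes a: "set_integrable lborel {0..T} a" and b: "set_integrable lborel {0..T} b" and T: "0 \<le> T"
    and eq: "\<And>t. t \<in> {0..T} \<Longrightarrow> cumul a t = cumul b t"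
  shows "AE u\<in>{0..T} in lborel. a u = b u"
proof -
  have ab: "set_integrable lborel {0..T} (\<lambda>u. a u - b u)"
    and ba: "set_integrable lborel {0..T} (\<lambda>u. b u - a u)"
    using a b by auto
  have "AE u\<in>{0..T} in lborel. 0 \<le> a u - b u"
    by (rule AE_nonneg_of_cumul_mono[OF ab T]) (auto intro!: mono_onI simp: cumul_diff_fun[OF a b] eq)
  moreover have "AE u\<in>{0..T} in lborel. 0 \<le> b u - a u"
    by (rule AE_nonneg_of_cumul_mono[OF ba T]) (auto intro!: mono_onI simp: cumul_diff_fun[OF b a] eq)
  ultimately show ?thesis by eventually_elim auto
qed

lemma continuous_on_dominated_increments:
  fixes H K :: "real \<Rightarrow> real"
  assumes K: "continuous_on {0..T} K"
    and inc: "\<And>s t. 0 \<le> s \<Longrightarrow> s \<le> t \<Longrightarrow> t \<le> T \<Longrightarrow> \<bar>H t - H s\<bar> \<le> \<bar>K t - K s\<bar>"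
  shows "continuous_on {0..T} H"
  unfolding continuous_on_iff
proof (intro ballI allI impI)
  fix x e :: real assume x: "x \<in> {0..T}" "0 < e"
  with K obtain d where d: "d > 0" "\<And>y. y \<in> {0..T} \<Longrightarrow> dist y x < d \<Longrightarrow> dist (K y) (K x) < e"
    unfolding continuous_on_iff by blast
  have "dist (H y) (H x) < e" if y: "y \<in> {0..T}" "dist y x < d" for y
    using inc[of x y] inc[of y x] d(2)[OF y] x y by (cases "x \<le> y") (auto simp: dist_real_def)
  with d(1) show "\<exists>d>0. \<forall>y\<in>{0..T}. dist y x < d \<longrightarrow> dist (H y) (H x) < e" by blast
qed

text \<open>The Stieltjes measures of \<open>H\<close> and of \<open>cumul h - H\<close> add up to the measure with density \<open>h\<close>, so
  the first one is absolutely continuous and the Radon-Nikodym theorem applies.\<close>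

lemma density_exists:
  assumes h: "set_integrable lborel {0..T} h" and nn: "\<And>u. 0 \<le> h u" and T: "0 \<le> T"
    and mono: "mono_on {0..T} H" and H0: "H 0 = 0"
    and inc: "\<And>s t. 0 \<le> s \<Longrightarrow> s \<le> t \<Longrightarrow> t \<le> T \<Longrightarrow> H t - H s \<le> cumul h t - cumul h s"
  obtains k where "k \<in> borel_measurable borel" "set_integrable lborel {0..T} k"
    "\<And>u. 0 \<le> k u" "AE u\<in>{0..T} in lborel. k u \<le> h u"
    "\<And>t. t \<in> {0..T} \<Longrightarrow> H t = cumul k t"
proof -
  have H_mono: "H s \<le> H t" if "0 \<le> s" "s \<le> t" "t \<le> T" for s t
    using mono_onD[OF mono, of s t] that by auto
  have contH: "continuous_on {0..T} H"
    by (rule continuous_on_dominated_increments[OF continuous_on_cumul[OF h]])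
       (use inc H_mono in fastforce)
  define M where "M = density lborel (\<lambda>u. ennreal (indicator {0..T} u * h u))"
  define N where "N = interval_measure (\<lambda>x. H (max 0 (min T x)))"
  define R where "R = interval_measure (\<lambda>x. cumul h (max 0 (min T x)) - H (max 0 (min T x)))"
  note M = cdf_density_set[OF h nn T, folded M_def]
  note N = cdf_interval_measure_clamp[OF contH mono H0 T, folded N_def]
  have "mono_on {0..T} (\<lambda>x. cumul h x - H x)"
    by (rule mono_onI) (use inc in \<open>force simp: algebra_simps\<close>)
  moreover have "cumul h 0 - H 0 = 0" using H0 by simp
  ultimately have R: "finite_borel_measure R" 
      "\<And>x. cdf R x = cumul h (max 0 (min T x)) - H (max 0 (min T x))"
    using cdf_interval_measure_clamp[OF continuous_on_diff[OF continuous_on_cumul[OF h] contH] _ _ T]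
    unfolding R_def by blast+
  note add = measure_add_eqI[OF N(1) R(1) M(1)]
  have "absolutely_continuous lborel N"
    unfolding absolutely_continuous_def
  proof
    fix A assume A: "A \<in> null_sets (lborel :: real measure)"
    then have "A \<in> null_sets M"
      using h by (auto simp: M_def null_sets_density_iff set_integrable_def AE_not_in[THEN eventually_mono])
    then have "measure M A = 0" by (simp add: measure_def null_setsD1)
    moreover have "A \<in> sets borel" using A by auto
    ultimately have "measure N A + measure R A = 0" using add[of A] N(2) R(2) M(2) by simp
    then have "measure N A = 0"
      by (metis add_nonneg_eq_0_iff measure_nonneg)
    then show "A \<in> null_sets N" using A N(1)
      by (auto simp: null_sets_def finite_borel_measure_def finite_measure.emeasure_eq_measure N_def)
  qed
  then obtain k' where k': "k' \<in> borel_measurable lborel" "density lborel k' = N"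
    using sigma_finite_measure.Radon_Nikodym[OF sigma_finite_lborel, of N] by (auto simp: N_def)
  have N_fin: "emeasure N UNIV < \<infinity>"
    unfolding infinity_ennreal_def less_top[symmetric]
    by (rule finite_measure.emeasure_finite[OF finite_borel_measure.axioms(1)[OF N(1)]])
  then have int: "(\<integral>\<^sup>+u. k' u \<partial>lborel) < \<infinity>"
    unfolding k'(2)[symmetric] using k'(1) by (simp add: emeasure_density)
  then have fin: "AE u in lborel. k' u \<noteq> \<infinity>"
    using k'(1) by (intro nn_integral_PInf_AE) auto
  define k where "k u = enn2real (k' u)" for u
  have k: "k \<in> borel_measurable borel" "\<And>u. 0 \<le> k u" using k' by (auto simp: k_def[abs_def])
  have ek: "AE u in lborel. ennreal (k u) = k' u" using fin by eventually_elim (simp add: k_def ennreal_enn2real flip: less_top)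
  have ki: "integrable lborel k"
  proof (rule integrableI_nonneg)
    show "(\<integral>\<^sup>+u. ennreal (k u) \<partial>lborel) < \<infinity>"
      using int nn_integral_cong_AE[OF ek] by simp
  qed (use k in auto)
  then have kS: "set_integrable lborel S k" if "S \<in> sets borel" for S
    using that unfolding set_integrable_def by (intro integrable_mult_indicator) auto
  then have ks: "set_integrable lborel {0..T} k" by simp
  have Hk: "H t = cumul k t" if t: "t \<in> {0..T}" for t
  proof -
    have em: "emeasure N A = ennreal (LINT u:A|lborel. k u)" if A: "A \<in> sets borel" for A
    proof -
      have "emeasure N A = (\<integral>\<^sup>+u. k' u * indicator A u \<partial>lborel)"
        unfolding k'(2)[symmetric] using k'(1) A by (simp add: emeasure_density)
      also have "\<dots> = (\<integral>\<^sup>+u. ennreal (indicator A u * k u) \<partial>lborel)"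
        by (rule nn_integral_cong_AE) (use ek in eventually_elim, auto simp: indicator_def)
      also have "\<dots> = ennreal (LINT u:A|lborel. k u)"
        unfolding set_lebesgue_integral_def using k A
        by (subst nn_integral_eq_integral) (auto intro!: integrable_mult_indicator[of A lborel k, simplified] ki)
      finally show ?thesis .
    qed
    have "cdf N t = (LINT u:{..t}|lborel. k u)"
      unfolding cdf_def measure_def using em[of "{..t}"] k 
      by (auto intro!: integral_nonneg_AE simp: set_lebesgue_integral_def)
    also have "\<dots> = (LINT u:{..<0}|lborel. k u) + (LINT u:{0..t}|lborel. k u)"
    proof -
      have eq: "{..t} = {..<0} \<union> {0..t}" using t by auto
      show ?thesis unfolding eq by (intro set_integral_Un kS) auto
    qed
    \<comment> \<open>The distribution function also counts mass to the left of 0. There is none,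
      because clamping gives \<open>cdf N 0 = H 0 = 0\<close>.\<close>
    also have "(LINT u:{..<0}|lborel. k u) = 0"
    proof -
      have "ennreal (LINT u:{..<0}|lborel. k u) = emeasure N {..<0}" using em by simp
      also have "\<dots> \<le> emeasure N {..0}" by (intro emeasure_mono) (auto simp: N_def)
      also have "\<dots> = 0" using N H0 T
        by (simp add: cdf_def finite_borel_measure_def finite_measure.emeasure_eq_measure)
      finally show ?thesis using k
        by (simp add: ennreal_eq_0_iff) (metis (no_types, lifting) antisym integral_nonneg_AE set_lebesgue_integral_def AE_I2 scaleR_nonneg_nonneg indicator_pos_le)
    qed
    finally show ?thesis using N(2)[of t] t by (simp add: cumul_def)
  qed
  \<comment> \<open>The domination of increments says exactly that the primitive of
    \<open>h - k\<close> is nondecreasing.\<close>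
  have "AE u\<in>{0..T} in lborel. 0 \<le> h u - k u"
  proof (rule AE_nonneg_of_cumul_mono[OF _ T])
    show "set_integrable lborel {0..T} (\<lambda>u. h u - k u)" using h ks by auto
    show "mono_on {0..T} (cumul (\<lambda>u. h u - k u))"
      using inc Hk by (auto intro!: mono_onI simp: cumul_diff_fun[OF h ks] algebra_simps)
  qed
  then have "AE u\<in>{0..T} in lborel. k u \<le> h u" by eventually_elim auto
  then show ?thesis using that[OF k(1) ks k(2)] Hk by blast
qed

section \<open>Chain rule for indefinite integrals\<close>

lemma set_integrable_mult_bounded:
  fixes a z :: "'a \<Rightarrow> real"
  assumes a: "set_integrable M S a" and z: "set_borel_measurable M S z" and S: "S \<in> sets M"
    and bd: "AE u\<in>S in M. \<bar>z u\<bar> \<le> C"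
  shows "set_integrable M S (\<lambda>u. z u * a u)"
proof -
  have eq: "indicat_real S u *\<^sub>R (z u * a u) = (indicat_real S u *\<^sub>R z u) * (indicat_real S u *\<^sub>R a u)" for u
    by (auto simp: indicator_def)
  have "integrable M (\<lambda>u. C * (indicat_real S u *\<^sub>R a u))"
    using a by (simp add: set_integrable_def)
  moreover have "(\<lambda>u. indicat_real S u *\<^sub>R (z u * a u)) \<in> borel_measurable M"
    using a z unfolding eq set_integrable_def set_borel_measurable_def by measurable
  moreover have "AE u in M. norm (indicat_real S u *\<^sub>R (z u * a u)) \<le> norm (C * (indicat_real S u *\<^sub>R a u))"
    using bd by eventually_elim (auto simp: indicator_def abs_mult intro!: mult_right_mono)
  ultimately show ?thesis
    unfolding set_integrable_def by (rule Bochner_Integration.integrable_bound)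
qed

lemma set_borel_measurable_continuous_on_Icc:
  fixes x :: "real \<Rightarrow> real"
  assumes "continuous_on {a..b} x"
  shows "set_borel_measurable lborel {a..b} x"
  unfolding set_borel_measurable_def
  using borel_measurable_continuous_on_indicator[OF _ assms] by simp

lemma set_borel_measurable_of_bool_less:
  fixes x :: "real \<Rightarrow> real"
  assumes "set_borel_measurable M S x" and S: "S \<in> sets M"
  shows "set_borel_measurable M S (\<lambda>u. of_bool (x u < c) :: real)"
proof -
  \<comment> \<open>Off \<open>S\<close> the comparison on the right becomes \<open>0 < 0\<close>,
    so the indicator can be moved inside it.\<close>
  have "(\<lambda>u. indicat_real S u *\<^sub>R (of_bool (x u < c) :: real)) =
        (\<lambda>u. if indicat_real S u *\<^sub>R x u - c * indicat_real S u < 0 then 1 else 0)"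
    by (auto simp: indicator_def)
  also have "\<dots> \<in> borel_measurable M"
    using assms unfolding set_borel_measurable_def by measurable
  finally show ?thesis unfolding set_borel_measurable_def .
qed

lemma cumul_abs_diff_le:
  assumes a: "set_integrable lborel {0..T} a" and b: "set_integrable lborel {0..T} b"
    and le: "\<And>u. u \<in> {s<..t} \<Longrightarrow> \<bar>a u\<bar> \<le> b u" and st: "0 \<le> s" "s \<le> t" "t \<le> T"
  shows "\<bar>cumul a t - cumul a s\<bar> \<le> cumul b t - cumul b s"
proof -
  have i: "set_integrable lborel {s<..t} a" "set_integrable lborel {s<..t} b"
    using st by (auto intro: set_integrable_Icc_subset[OF a] set_integrable_Icc_subset[OF b])
  have "\<bar>LINT u:{s<..t}|lborel. a u\<bar> \<le> (LINT u:{s<..t}|lborel. \<bar>a u\<bar>)"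
    unfolding set_lebesgue_integral_def
    by (rule order_trans[OF integral_abs_bound]) (simp add: abs_mult)
  also have "\<dots> \<le> (LINT u:{s<..t}|lborel. b u)"
    using i le by (intro set_integral_mono set_integrable_abs) auto
  finally show ?thesis
    using cumul_diff[OF a st] cumul_diff[OF b st] by simp
qed

text \<open>The error is additive over adjacent intervals, and on short intervals it is at most
  \<open>e * \<integral>\<bar>\<xi>\<bar>\<close>; bisection extends this bound to all intervals.\<close>

lemma chain_rule_C1:
  assumes \<xi>: "set_integrable lborel {0..T} \<xi>"
    and x: "\<And>t. t \<in> {0..T} \<Longrightarrow> x t = x 0 + cumul \<xi> t"
    and \<phi>: "\<And>y. (\<phi> has_field_derivative \<phi>' y) (at y)" and \<phi>': "continuous_on UNIV \<phi>'"
    and t: "t \<in> {0..T}"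
  shows "set_integrable lborel {0..T} (\<lambda>u. \<phi>' (x u) * \<xi> u)"
    and "\<phi> (x t) = \<phi> (x 0) + cumul (\<lambda>u. \<phi>' (x u) * \<xi> u) t"
proof -
  have contx: "continuous_on {0..T} x"
    by (rule continuous_on_eq[OF continuous_on_add[OF continuous_on_const continuous_on_cumul[OF \<xi>]] x[symmetric]])
  have cont: "continuous_on {0..T} (\<lambda>u. \<phi>' (x u))"
    by (rule continuous_on_compose2[OF \<phi>' contx]) auto
  obtain C where C: "\<And>u. u \<in> {0..T} \<Longrightarrow> \<bar>\<phi>' (x u)\<bar> \<le> C"
    using compact_imp_bounded[OF compact_continuous_image[OF cont compact_Icc]]
    unfolding bounded_iff by (metis imageI real_norm_def)
  show i: "set_integrable lborel {0..T} (\<lambda>u. \<phi>' (x u) * \<xi> u)"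
    by (rule set_integrable_mult_bounded[OF \<xi> set_borel_measurable_continuous_on_Icc[OF cont]])
       (use C in auto)
  have ab: "set_integrable lborel {0..T} (\<lambda>u. \<bar>\<xi> u\<bar>)" using set_integrable_abs[OF \<xi>] .
  let ?J = "cumul (\<lambda>u. \<phi>' (x u) * \<xi> u)" and ?N = "cumul (\<lambda>u. \<bar>\<xi> u\<bar>)"
  have N0: "0 \<le> ?N t"
    using cumul_abs_diff_le[OF \<xi> ab, of 0 t] t by auto
  have main: "\<bar>\<phi> (x t) - \<phi> (x 0) - (?J t - ?J 0)\<bar> \<le> e * (?N t - ?N 0)" if e: "e > 0" for e
  proof -
    define P where "P a b \<longleftrightarrow> (0 \<le> a \<longrightarrow> a \<le> b \<longrightarrow> b \<le> T \<longrightarrow>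
      \<bar>\<phi> (x b) - \<phi> (x a) - (?J b - ?J a)\<bar> \<le> e * (?N b - ?N a))" for a b
    have "0 \<le> t" using t by simp
    then have "P 0 t"
    proof (induction rule: Bolzano)
      case (trans a b c)
      show ?case unfolding P_def
      proof (intro impI)
        assume "0 \<le> a" "a \<le> c" "c \<le> T"
        then have "\<bar>\<phi> (x b) - \<phi> (x a) - (?J b - ?J a)\<bar> \<le> e * (?N b - ?N a)"
          "\<bar>\<phi> (x c) - \<phi> (x b) - (?J c - ?J b)\<bar> \<le> e * (?N c - ?N b)"
          using trans unfolding P_def by auto
        then show "\<bar>\<phi> (x c) - \<phi> (x a) - (?J c - ?J a)\<bar> \<le> e * (?N c - ?N a)"
          by (simp add: algebra_simps abs_le_iff)
      qed
    next
      case (local z)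
      then have z: "z \<in> {0..T}" using t by auto
      have "continuous (at (x z)) \<phi>'"
        using \<phi>' by (simp add: continuous_on_eq_continuous_at)
      \<comment> \<open>\<open>e/2\<close> is spent twice: on the mean value inequality for
        \<open>\<phi>\<close> minus its linear part at \<open>x z\<close>, and on replacing
        \<open>\<phi>' (x u)\<close> by \<open>\<phi>' (x z)\<close> under the integral.\<close>
      then obtain d1 where d1: "d1 > 0" "\<And>y. dist y (x z) < d1 \<Longrightarrow> dist (\<phi>' y) (\<phi>' (x z)) < e/2"
        unfolding continuous_at_eps_delta using e half_gt_zero by blast
      obtain d where d: "d > 0" "\<And>y. y \<in> {0..T} \<Longrightarrow> dist y z < d \<Longrightarrow> dist (x y) (x z) < d1"
        using contx z d1(1) unfolding continuous_on_iff by blast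
      have "P a b" if ab': "a \<le> z" "z \<le> b" "b - a < d" for a b
        unfolding P_def
      proof (intro impI)
        assume A: "0 \<le> a" "a \<le> b" "b \<le> T"
        have near: "dist (x u) (x z) < d1" if "u \<in> {a..b}" for u
          using that A ab' by (intro d(2)) (auto simp: dist_real_def)
        have \<phi>'_near: "\<bar>\<phi>' (x u) - \<phi>' (x z)\<bar> \<le> e/2" if "u \<in> {a..b}" for u
          using d1(2)[OF near[OF that]] by (simp add: dist_real_def)
        have mvt: "\<bar>\<phi> (x b) - \<phi> (x a) - \<phi>' (x z) * (x b - x a)\<bar> \<le> e/2 * \<bar>x b - x a\<bar>"
        proof -
          let ?B = "ball (x z) d1"
          have in_B: "x a \<in> ?B" "x b \<in> ?B" using near[of a] near[of b] A ab'
            by (auto simp: dist_commute)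
          have "norm ((\<lambda>y. \<phi> y - \<phi>' (x z) * y) (x b) - (\<lambda>y. \<phi> y - \<phi>' (x z) * y) (x a)) \<le> e/2 * norm (x b - x a)"
          proof (rule field_differentiable_bound[of ?B _ "\<lambda>y. \<phi>' y - \<phi>' (x z)"])
            fix y assume y: "y \<in> ?B"
            show "((\<lambda>y. \<phi> y - \<phi>' (x z) * y) has_field_derivative \<phi>' y - \<phi>' (x z)) (at y within ?B)"
              by (rule has_field_derivative_at_within) (auto intro!: derivative_eq_intros \<phi>)
            show "norm (\<phi>' y - \<phi>' (x z)) \<le> e/2"
              using d1(2)[of y] y by (simp add: dist_commute[of "x z"]) (simp add: dist_real_def)
          qed (use in_B in auto)
          then show ?thesis by (simp add: algebra_simps)
        qed
        have xd: "x b - x a = cumul \<xi> b - cumul \<xi> a" using x[of a] x[of b] A by auto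
        have xN: "\<bar>x b - x a\<bar> \<le> ?N b - ?N a"
          unfolding xd using A by (intro cumul_abs_diff_le[OF \<xi> ab]) auto
        have i1: "set_integrable lborel {0..T} (\<lambda>u. \<phi>' (x z) * \<xi> u)" using \<xi> by auto
        have i2: "set_integrable lborel {0..T} (\<lambda>u. \<phi>' (x u) * \<xi> u - \<phi>' (x z) * \<xi> u)" using i i1 by auto
        have i3: "set_integrable lborel {0..T} (\<lambda>u. e/2 * \<bar>\<xi> u\<bar>)" using ab by auto
        have "\<bar>cumul (\<lambda>u. \<phi>' (x u) * \<xi> u - \<phi>' (x z) * \<xi> u) b - cumul (\<lambda>u. \<phi>' (x u) * \<xi> u - \<phi>' (x z) * \<xi> u) a\<bar>
            \<le> cumul (\<lambda>u. e/2 * \<bar>\<xi> u\<bar>) b - cumul (\<lambda>u. e/2 * \<bar>\<xi> u\<bar>) a"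
        proof (rule cumul_abs_diff_le[OF i2 i3])
          fix u assume "u \<in> {a<..b}"
          then show "\<bar>\<phi>' (x u) * \<xi> u - \<phi>' (x z) * \<xi> u\<bar> \<le> e/2 * \<bar>\<xi> u\<bar>"
            using mult_right_mono[OF \<phi>'_near[of u] abs_ge_zero[of "\<xi> u"]]
            by (simp add: abs_mult flip: left_diff_distrib)
        qed (use A in auto)
        moreover have r1: "cumul (\<lambda>u. \<phi>' (x u) * \<xi> u - \<phi>' (x z) * \<xi> u) r = ?J r - \<phi>' (x z) * cumul \<xi> r"
          if "r \<le> T" for r
          using cumul_diff_fun[OF i i1 that] by (simp add: cumul_cmult)
        moreover have r2: "cumul (\<lambda>u. e/2 * \<bar>\<xi> u\<bar>) r = e/2 * ?N r" for r by (rule cumul_cmult)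
        ultimately have "\<bar>?J b - \<phi>' (x z) * cumul \<xi> b - (?J a - \<phi>' (x z) * cumul \<xi> a)\<bar> \<le> e/2 * ?N b - e/2 * ?N a"
          by (simp only: r1[OF A(3)] r1[OF order_trans[OF A(2,3)]] r2)
        also have "?J b - \<phi>' (x z) * cumul \<xi> b - (?J a - \<phi>' (x z) * cumul \<xi> a) = ?J b - ?J a - \<phi>' (x z) * (x b - x a)"
          unfolding xd by (simp add: algebra_simps)
        finally have J: "\<bar>?J b - ?J a - \<phi>' (x z) * (x b - x a)\<bar> \<le> e/2 * (?N b - ?N a)"
          by (simp only: right_diff_distrib)
        have "e/2 * \<bar>x b - x a\<bar> \<le> e/2 * (?N b - ?N a)"
          using xN e by (intro mult_left_mono) auto
        then have "\<bar>\<phi> (x b) - \<phi> (x a) - \<phi>' (x z) * (x b - x a)\<bar> \<le> e/2 * (?N b - ?N a)"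
          using mvt by simp
        with J have "\<bar>\<phi> (x b) - \<phi> (x a) - (?J b - ?J a)\<bar> \<le> e/2 * (?N b - ?N a) + e/2 * (?N b - ?N a)"
          by linarith
        then show "\<bar>\<phi> (x b) - \<phi> (x a) - (?J b - ?J a)\<bar> \<le> e * (?N b - ?N a)" by simp
      qed
      with d(1) show ?case by blast
    qed
    then show ?thesis using t unfolding P_def by auto
  qed
  have "\<bar>\<phi> (x t) - \<phi> (x 0) - ?J t\<bar> \<le> 0"
  proof (rule field_le_epsilon)
    fix e :: real assume e: "e > 0"
    \<comment> \<open>Adding 1 keeps the denominator positive when \<open>?N t = 0\<close>.\<close>
    have "e / (?N t + 1) * ?N t \<le> e" using N0 e by (simp add: field_simps)
    with main[of "e / (?N t + 1)"] N0 e show "\<bar>\<phi> (x t) - \<phi> (x 0) - ?J t\<bar> \<le> 0 + e"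
      by simp
  qed
  then show "\<phi> (x t) = \<phi> (x 0) + ?J t" by simp
qed

text \<open>The tangent error is at most \<open>(z - y)\<^sup>2\<close> for all sign combinations of
  \<open>y\<close> and \<open>z\<close>, so the kink at 0 needs no separate limit. Squaring the
  positive part is what makes the approximations of \<open>max 0 y\<close> below continuously
  differentiable.\<close>

lemma has_field_derivative_pos_part_square:
  "((\<lambda>y::real. (max 0 y)\<^sup>2) has_field_derivative 2 * max 0 y) (at y)"
proof -
  have bound: "\<bar>(max 0 z)\<^sup>2 - (max 0 y)\<^sup>2 - 2 * max 0 y * (z - y)\<bar> \<le> (z - y)\<^sup>2" for z :: real
  proof (cases "0 \<le> y"; cases "0 \<le> z")
    assume "0 \<le> y" "0 \<le> z"
    then have "(max 0 z)\<^sup>2 - (max 0 y)\<^sup>2 - 2 * max 0 y * (z - y) = (z - y)\<^sup>2"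
      by (simp add: power2_eq_square algebra_simps)
    then show ?thesis by simp
  next
    assume *: "0 \<le> y" "\<not> 0 \<le> z"
    then have eq: "(max 0 z)\<^sup>2 - (max 0 y)\<^sup>2 - 2 * max 0 y * (z - y) = y * y - 2 * (y * z)"
      by (simp add: max_def power2_eq_square algebra_simps)
    have "y * z \<le> 0" "0 \<le> y * y" "0 \<le> z * z" using * by (auto simp: mult_nonneg_nonpos)
    then have nn: "0 \<le> y * y - 2 * (y * z)" by linarith
    have "(z - y)\<^sup>2 = y * y - 2 * (y * z) + z * z" by (simp add: power2_eq_square algebra_simps)
    then show ?thesis unfolding eq abs_of_nonneg[OF nn] using \<open>0 \<le> z * z\<close> by linarith
  next
    assume *: "\<not> 0 \<le> y" "0 \<le> z"
    then have "z\<^sup>2 \<le> (z - y)\<^sup>2" by (intro power_mono) auto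
    with * show ?thesis by (simp add: max_def)
  qed (simp add: max_def)
  have "((\<lambda>z. ((max 0 z)\<^sup>2 - (max 0 y)\<^sup>2) / (z - y) - 2 * max 0 y) \<longlongrightarrow> 0) (at y)"
  proof (rule tendsto_0_le[where K = 1])
    show "((\<lambda>z. z - y) \<longlongrightarrow> 0) (at y)" by (auto intro!: tendsto_eq_intros)
    have "norm (((max 0 z)\<^sup>2 - (max 0 y)\<^sup>2) / (z - y) - 2 * max 0 y) \<le> norm (z - y) * 1" if "z \<noteq> y" for z
    proof -
      have "((max 0 z)\<^sup>2 - (max 0 y)\<^sup>2) / (z - y) - 2 * max 0 y =
          ((max 0 z)\<^sup>2 - (max 0 y)\<^sup>2 - 2 * max 0 y * (z - y)) / (z - y)"
        using that by (simp add: field_simps)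
      moreover have "(z - y)\<^sup>2 / \<bar>z - y\<bar> = \<bar>z - y\<bar>"
        using that by (simp add: power2_eq_square divide_simps flip: abs_mult)
      ultimately show ?thesis using divide_right_mono[OF bound, of "\<bar>z - y\<bar>" z] by simp
    qed
    then show "\<forall>\<^sub>F z in at y. norm (((max 0 z)\<^sup>2 - (max 0 y)\<^sup>2) / (z - y) - 2 * max 0 y) \<le> norm (z - y) * 1"
      by (auto simp: eventually_at_filter)
  qed
  then show ?thesis unfolding has_field_derivative_iff by (rule LIM_zero_cancel)
qed

text \<open>Dominated convergence in the C1 rule: the derivatives of the approximations stay in
  [0,1] and converge everywhere to \<open>of_bool (y > 0)\<close>. They are exactly 0 at
  \<open>y = 0\<close>, so times with \<open>x u = 0\<close> contribute nothing, whatever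
  \<open>\<xi>\<close> is there.\<close>

lemma chain_rule_pos_part:
  assumes \<xi>: "set_integrable lborel {0..T} \<xi>"
    and x: "\<And>t. t \<in> {0..T} \<Longrightarrow> x t = x 0 + cumul \<xi> t"
    and t: "t \<in> {0..T}"
  shows "max 0 (x t) = max 0 (x 0) + cumul (\<lambda>u. of_bool (x u > 0) * \<xi> u) t"
proof -
  \<comment> \<open>approximate the positive part of \<open>y\<close> by \<open>sqrt ((max 0 y)\<^sup>2 + \<epsilon> n)\<close>\<close>
  define \<epsilon> where "\<epsilon> n = 1 / real (Suc n)" for n
  have \<epsilon>: "\<epsilon> n > 0" for n by (simp add: \<epsilon>_def)
  have \<epsilon>_lim: "\<epsilon> \<longlonglongrightarrow> 0" unfolding \<epsilon>_def using LIMSEQ_inverse_real_of_nat by (simp add: inverse_eq_divide)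
  define \<phi> where "\<phi> n y = sqrt ((max 0 y)\<^sup>2 + \<epsilon> n)" for n and y :: real
  define \<phi>' where "\<phi>' n y = max 0 y / sqrt ((max 0 y)\<^sup>2 + \<epsilon> n)" for n and y :: real
  have pos: "0 < (max 0 y)\<^sup>2 + \<epsilon> n" for y n using \<epsilon> by (simp add: add_nonneg_pos)
  have der: "(\<phi> n has_field_derivative \<phi>' n y) (at y)" for n y
  proof -
    have "((\<lambda>y. (max 0 y)\<^sup>2 + \<epsilon> n) has_field_derivative 2 * max 0 y) (at y)"
      using DERIV_add[OF has_field_derivative_pos_part_square DERIV_const] by simp
    from DERIV_chain2[OF DERIV_real_sqrt[OF pos] this] show ?thesis
      unfolding \<phi>_def \<phi>'_def by (simp add: field_simps)
  qed
  have cont: "continuous_on UNIV (\<phi>' n)" for n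
    unfolding \<phi>'_def using pos by (intro continuous_intros) (auto simp: less_imp_neq[THEN not_sym])
  have le1: "0 \<le> \<phi>' n y" "\<phi>' n y \<le> 1" for n y
  proof -
    have "sqrt ((max 0 y)\<^sup>2) \<le> sqrt ((max 0 y)\<^sup>2 + \<epsilon> n)"
      using \<epsilon>[of n] by (intro real_sqrt_le_mono) simp
    then show "0 \<le> \<phi>' n y" "\<phi>' n y \<le> 1"
      using pos[of y n] by (auto simp: \<phi>'_def divide_le_eq_1)
  qed
  have lim\<phi>: "(\<lambda>n. \<phi> n y) \<longlonglongrightarrow> max 0 y" for y
    unfolding \<phi>_def using tendsto_real_sqrt[OF tendsto_add[OF tendsto_const \<epsilon>_lim], of "(max 0 y)\<^sup>2"] by simp
  have lim\<phi>': "(\<lambda>n. \<phi>' n y) \<longlonglongrightarrow> of_bool (y > 0)" for y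
  proof (cases "y > 0")
    case True
    then show ?thesis using tendsto_divide[OF tendsto_const lim\<phi>, of y "max 0 y"]
      unfolding \<phi>'_def \<phi>_def by simp
  qed (simp add: \<phi>'_def max_def)
  note C1 = chain_rule_C1[OF \<xi> x der cont t]
  have contx: "continuous_on {0..T} x"
    by (rule continuous_on_eq[OF continuous_on_add[OF continuous_on_const continuous_on_cumul[OF \<xi>]] x[symmetric]])
  have xi_t: "set_integrable lborel {0..t} \<xi>" using \<xi> t by (auto intro: set_integrable_Icc_subset)
  have "set_integrable lborel {0..T} (\<lambda>u. of_bool (0 < x u) * \<xi> u)"
  proof (rule set_integrable_mult_bounded[OF \<xi>, where C = 1])
    have "set_borel_measurable lborel {0..T} (\<lambda>u. - x u)"
      by (intro set_borel_measurable_continuous_on_Icc continuous_intros contx)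
    from set_borel_measurable_of_bool_less[OF this, of 0]
    show "set_borel_measurable lborel {0..T} (\<lambda>u. of_bool (0 < x u) :: real)" by simp
  qed auto
  then have i: "set_integrable lborel {0..t} (\<lambda>u. of_bool (0 < x u) * \<xi> u)"
    using t by (auto intro: set_integrable_Icc_subset)
  have "(\<lambda>n. cumul (\<lambda>u. \<phi>' n (x u) * \<xi> u) t) \<longlonglongrightarrow> cumul (\<lambda>u. of_bool (x u > 0) * \<xi> u) t"
    unfolding cumul_def set_lebesgue_integral_def
  proof (rule integral_dominated_convergence)
    show "integrable lborel (\<lambda>u. \<bar>indicator {0..t} u *\<^sub>R \<xi> u\<bar>)"
      using xi_t by (simp add: set_integrable_def)
    show "(\<lambda>u. indicat_real {0..t} u *\<^sub>R (of_bool (0 < x u) * \<xi> u)) \<in> borel_measurable lborel"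
      using i by (auto simp: set_integrable_def)
    show "(\<lambda>u. indicat_real {0..t} u *\<^sub>R (\<phi>' n (x u) * \<xi> u)) \<in> borel_measurable lborel" for n
      using set_integrable_Icc_subset[OF C1(1)[of n], of "{0..t}"] t by (auto simp: set_integrable_def)
    show "AE u in lborel. (\<lambda>n. indicat_real {0..t} u *\<^sub>R (\<phi>' n (x u) * \<xi> u))
        \<longlonglongrightarrow> indicat_real {0..t} u *\<^sub>R (of_bool (0 < x u) * \<xi> u)"
      by (intro AE_I2 tendsto_intros lim\<phi>')
    show "AE u in lborel. norm (indicat_real {0..t} u *\<^sub>R (\<phi>' n (x u) * \<xi> u)) \<le> \<bar>indicator {0..t} u *\<^sub>R \<xi> u\<bar>" for n
    proof (rule AE_I2)
      fix u
      have "\<bar>\<phi>' n (x u)\<bar> * \<bar>\<xi> u\<bar> \<le> 1 * \<bar>\<xi> u\<bar>" using le1[where n=n and y = "x u"] by (intro mult_right_mono) auto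
      then show "norm (indicat_real {0..t} u *\<^sub>R (\<phi>' n (x u) * \<xi> u)) \<le> \<bar>indicator {0..t} u *\<^sub>R \<xi> u\<bar>"
        by (auto simp: abs_mult indicator_def)
    qed
  qed
  then have "(\<lambda>n. \<phi> n (x 0) + cumul (\<lambda>u. \<phi>' n (x u) * \<xi> u) t) \<longlonglongrightarrow> max 0 (x 0) + cumul (\<lambda>u. of_bool (x u > 0) * \<xi> u) t"
    by (intro tendsto_intros lim\<phi>)
  moreover have "(\<lambda>n. \<phi> n (x t)) \<longlonglongrightarrow> max 0 (x t)" by (rule lim\<phi>)
  ultimately show ?thesis using C1(2) by (simp add: LIMSEQ_unique)
qed

section \<open>Convolution\<close>

lemma integrable_lborel_prod:
  fixes a b :: "real \<Rightarrow> real"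
  assumes a: "integrable lborel a" and b: "integrable lborel b"
  shows "integrable (lborel \<Otimes>\<^sub>M lborel) (\<lambda>(x, y). a x * b y)"
proof (rule lborel_pair.Fubini_integrable)
  have [measurable]: "a \<in> borel_measurable borel" "b \<in> borel_measurable borel" using a b by auto
  show "(\<lambda>(x, y). a x * b y) \<in> borel_measurable (lborel \<Otimes>\<^sub>M lborel)" by measurable
  have "integrable lborel (\<lambda>x. \<bar>a x\<bar> * (LINT y|lborel. \<bar>b y\<bar>))"
    using a by auto
  then show "integrable lborel (\<lambda>x. LINT y|lborel. norm (case (x, y) of (x, y) \<Rightarrow> a x * b y))"
    by (simp add: abs_mult)
  show "AE x in lborel. integrable lborel (\<lambda>y. case (x, y) of (x, y) \<Rightarrow> a x * b y)"
    using b by auto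
qed

text \<open>By Fubini both sides are the integral of \<open>a u * b w\<close> over the triangle
  \<open>0 \<le> u\<close>, \<open>0 \<le> w\<close>, \<open>u + w \<le> t\<close>.\<close>

lemma convolution_by_parts:
  assumes a: "set_integrable lborel {0..T} a" and b: "set_integrable lborel {0..T} b" and t: "t \<in> {0..T}"
  shows "(LINT u:{0..t}|lborel. cumul b (t - u) * a u) = (LINT w:{0..t}|lborel. b w * cumul a (t - w))"
proof -
  let ?a = "\<lambda>u. indicat_real {0..T} u * a u" and ?b = "\<lambda>u. indicat_real {0..T} u * b u"
  have ia: "integrable lborel ?a" and ib: "integrable lborel ?b"
    using a b by (auto simp: set_integrable_def)
  let ?S = "{p. 0 \<le> fst p \<and> 0 \<le> snd p \<and> fst p + snd p \<le> t} :: (real \<times> real) set"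
  have "{p \<in> space (borel \<Otimes>\<^sub>M borel). 0 \<le> fst p \<and> 0 \<le> snd p \<and> fst p + snd p \<le> t} \<in> sets (borel \<Otimes>\<^sub>M borel)"
    by measurable
  then have S: "?S \<in> sets (borel \<Otimes>\<^sub>M borel)" by (simp add: space_pair_measure)
  let ?k = "\<lambda>(u, w). indicat_real ?S (u, w) * (?a u * ?b w)"
  have k: "integrable (lborel \<Otimes>\<^sub>M lborel) ?k"
    using integrable_mult_indicator[OF _ integrable_lborel_prod[OF ia ib], of ?S] S
    by (simp add: case_prod_unfold)
  have "(LINT u:{0..t}|lborel. cumul b (t - u) * a u) = (LINT u|lborel. LINT w|lborel. ?k (u, w))"
    unfolding set_lebesgue_integral_def
  proof (rule Bochner_Integration.integral_cong[OF refl])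
    fix u
    show "indicat_real {0..t} u *\<^sub>R (cumul b (t - u) * a u) = (LINT w|lborel. ?k (u, w))"
    proof (cases "u \<in> {0..t}")
      case True
      have "(LINT w|lborel. ?k (u, w)) = (LINT w|lborel. a u * (indicator {0..t-u} w *\<^sub>R b w))"
        using True t by (intro Bochner_Integration.integral_cong) (auto simp: indicator_def)
      also have "\<dots> = a u * cumul b (t - u)" by (simp add: cumul_def set_lebesgue_integral_def)
      finally show ?thesis using True by simp
    next
      case False
      then have "(\<lambda>w. ?k (u, w)) = (\<lambda>_. 0)" by (auto simp: indicator_def)
      with False show ?thesis by simp
    qed
  qed
  also have "\<dots> = (LINT w|lborel. LINT u|lborel. ?k (u, w))"
    using lborel_pair.Fubini_integral[of "\<lambda>u w. ?k (u, w)"] k by (simp add: case_prod_unfold)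
  also have "\<dots> = (LINT w:{0..t}|lborel. b w * cumul a (t - w))"
    unfolding set_lebesgue_integral_def
  proof (rule Bochner_Integration.integral_cong[OF refl])
    fix w
    show "(LINT u|lborel. ?k (u, w)) = indicat_real {0..t} w *\<^sub>R (b w * cumul a (t - w))"
    proof (cases "w \<in> {0..t}")
      case True
      have "(LINT u|lborel. ?k (u, w)) = (LINT u|lborel. b w * (indicator {0..t-w} u *\<^sub>R a u))"
        using True t by (intro Bochner_Integration.integral_cong) (auto simp: indicator_def)
      also have "\<dots> = b w * cumul a (t - w)" by (simp add: cumul_def set_lebesgue_integral_def)
      finally show ?thesis using True by simp
    next
      case False
      then have "(\<lambda>u. ?k (u, w)) = (\<lambda>_. 0)" by (auto simp: indicator_def)
      with False show ?thesis by simp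
    qed
  qed
  finally show ?thesis .
qed

text \<open>The second argument is meant to be a cumulative quantity. For \<open>k = g\<close> and
  \<open>A = cumul a\<close>, integration by parts identifies this with the fluid of input rate
  \<open>a\<close> whose service is completed by time \<open>t\<close>.\<close>

definition conv :: "(real \<Rightarrow> real) \<Rightarrow> (real \<Rightarrow> real) \<Rightarrow> real \<Rightarrow> real" where
  "conv k A t = (LINT w:{0..t}|lborel. k w * A (t - w))"

lemma set_integrable_conv:
  fixes k A :: "real \<Rightarrow> real"
  assumes k: "k \<in> borel_measurable borel" "\<And>w. \<bar>k w\<bar> \<le> C"
    and A: "continuous_on {0..T} A" and t: "t \<le> T"
  shows "set_integrable lborel {0..t} (\<lambda>w. k w * A (t - w))"
proof (rule set_integrable_mult_bounded[where z = k and C = C])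
  have "continuous_on {0..t} (\<lambda>w. A (t - w))"
    by (rule continuous_on_compose2[OF A]) (use t in \<open>auto intro!: continuous_intros\<close>)
  then show "set_integrable lborel {0..t} (\<lambda>w. A (t - w))" by (rule borel_integrable_atLeastAtMost')
  show "set_borel_measurable lborel {0..t} k"
    using k(1) unfolding set_borel_measurable_def by measurable
qed (use k in auto)

text \<open>With the time shift on \<open>A\<close> rather than on the kernel, the integrand and the
  domain both grow with \<open>t\<close>, so an arbitrary nonnegative kernel is allowed.\<close>

lemma conv_mono:
  fixes k A :: "real \<Rightarrow> real"
  assumes k: "k \<in> borel_measurable borel" "\<And>w. 0 \<le> k w" "\<And>w. k w \<le> C"
    and A: "continuous_on {0..T} A" "mono_on {0..T} A" "0 \<le> A 0"
    and st: "s \<le> t" "t \<le> T"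
  shows "conv k A s \<le> conv k A t"
proof -
  have nn: "0 \<le> A v" if "0 \<le> v" "v \<le> T" for v
    using mono_onD[OF A(2), of 0 v] A(3) that by auto
  have i: "set_integrable lborel {0..r} (\<lambda>w. k w * A (r - w))" if "r \<le> T" for r
    using k by (intro set_integrable_conv[OF k(1) _ A(1) that]) (auto simp: abs_of_nonneg)
  show ?thesis
    unfolding conv_def set_lebesgue_integral_def
  proof (rule integral_mono)
    fix w
    show "indicat_real {0..s} w *\<^sub>R (k w * A (s - w)) \<le> indicat_real {0..t} w *\<^sub>R (k w * A (t - w))"
      using st k(2)[of w] nn[of "t - w"] mono_onD[OF A(2), of "s - w" "t - w"]
      by (auto simp: indicator_def intro!: mult_left_mono)
  qed (use i st in \<open>auto simp: set_integrable_def\<close>)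
qed

lemma conv_one: "conv (\<lambda>_. 1) A t = cumul A t"
proof -
  have "cumul A t = (LINT w|lborel. indicat_real {0..t} (t + (-1) * w) *\<^sub>R A (t + (-1) * w))"
    unfolding cumul_def set_lebesgue_integral_def by (subst lborel_integral_real_affine[of "-1" _ t]) auto
  also have "\<dots> = conv (\<lambda>_. 1) A t"
    unfolding conv_def set_lebesgue_integral_def
    by (intro Bochner_Integration.integral_cong) (auto simp: indicator_def)
  finally show ?thesis by simp
qed

text \<open>\<open>k\<close> is merely measurable, so its shifts cannot be compared. Instead the
  convolution with \<open>C - k\<close> is nondecreasing as well, which bounds the increments of
  \<open>conv k A\<close> by those of \<open>C * cumul A\<close>, and
  \<open>A \<le> A T\<close>.\<close>

lemma conv_increment_le:
  fixes k A :: "real \<Rightarrow> real"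
  assumes k: "k \<in> borel_measurable borel" "\<And>w. 0 \<le> k w" "\<And>w. k w \<le> C"
    and A: "continuous_on {0..T} A" "mono_on {0..T} A" "0 \<le> A 0"
    and st: "0 \<le> s" "s \<le> t" "t \<le> T"
  shows "conv k A t - conv k A s \<le> C * A T * (t - s)"
proof -
  have C: "0 \<le> C" using k(2,3) order_trans by blast
  have kC: "\<bar>k w\<bar> \<le> C" for w using k by (simp add: abs_of_nonneg)
  have i: "set_integrable lborel {0..r} (\<lambda>w. k w * A (r - w))"
    and i1: "set_integrable lborel {0..r} (\<lambda>w. C * A (r - w))" if "r \<le> T" for r
    using set_integrable_conv[OF k(1) kC A(1) that] C set_integrable_conv[of "\<lambda>_. C" C, OF _ _ A(1) that] by auto
  have eq: "conv (\<lambda>w. C - k w) A r = C * cumul A r - conv k A r" if "r \<le> T" for r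
  proof -
    have "conv (\<lambda>w. C - k w) A r = (LINT w:{0..r}|lborel. C * A (r - w)) - conv k A r"
      unfolding conv_def using i[OF that] i1[OF that]
      by (subst set_integral_diff(2)[symmetric]) (auto simp: algebra_simps)
    also have "(LINT w:{0..r}|lborel. C * A (r - w)) = C * conv (\<lambda>_. 1) A r"
      unfolding conv_def by simp
    finally show ?thesis by (simp add: conv_one)
  qed
  \<comment> \<open>monotonicity of the convolution with the complementary kernel \<open>C - k\<close>\<close>
  have "conv (\<lambda>w. C - k w) A s \<le> conv (\<lambda>w. C - k w) A t"
    using k st by (intro conv_mono[OF _ _ _ A, where C = C]) auto
  then have "conv k A t - conv k A s \<le> C * (cumul A t - cumul A s)"
    using st by (simp add: eq algebra_simps)
  also have "\<dots> \<le> C * (cumul (\<lambda>_. A T) t - cumul (\<lambda>_. A T) s)"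
  proof (intro mult_left_mono C)
    have iA: "set_integrable lborel {0..T} A" by (rule borel_integrable_atLeastAtMost'[OF A(1)])
    have "\<bar>cumul A t - cumul A s\<bar> \<le> cumul (\<lambda>_. A T) t - cumul (\<lambda>_. A T) s"
    proof (rule cumul_abs_diff_le[OF iA _ _ st])
      fix u assume "u \<in> {s<..t}"
      then show "\<bar>A u\<bar> \<le> A T" using mono_onD[OF A(2), of 0 u] mono_onD[OF A(2), of u T] A(3) st by auto
    qed (auto intro: borel_integrable_atLeastAtMost')
    then show "cumul A t - cumul A s \<le> cumul (\<lambda>_. A T) t - cumul (\<lambda>_. A T) s" by simp
  qed
  also have "cumul (\<lambda>_. A T) t - cumul (\<lambda>_. A T) s = A T * (t - s)"
    using st by (simp add: cumul_def set_integral_const algebra_simps)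
  finally show ?thesis by (simp add: mult.assoc)
qed

section \<open>The one-sided Skorokhod regulator\<close>

lemma continuous_on_Icc_bounded:
  fixes h :: "real \<Rightarrow> real"
  assumes "continuous_on {a..b} h"
  obtains N where "\<And>u. u \<in> {a..b} \<Longrightarrow> \<bar>h u\<bar> \<le> N"
  using compact_imp_bounded[OF compact_continuous_image[OF assms compact_Icc]]
  unfolding bounded_iff by (metis imageI real_norm_def)

text \<open>The running maximum of the excess over \<open>c\<close> is the classical explicit
  solution of the reflection problem: the least nondecreasing process from 0 or above whose
  subtraction keeps \<open>y\<close> at or below \<open>c\<close>.\<close>

definition regulator :: "real \<Rightarrow> (real \<Rightarrow> real) \<Rightarrow> real \<Rightarrow> real" where
  "regulator c y t = (SUP s\<in>{0..t}. max 0 (y s - c))"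

lemma
  assumes y: "continuous_on {0..T} y" and t: "t \<in> {0..T}"
  shows regulator_attained: "\<exists>s\<in>{0..t}. regulator c y t = max 0 (y s - c)"
    and regulator_ge: "s \<in> {0..t} \<Longrightarrow> max 0 (y s - c) \<le> regulator c y t"
proof -
  have "continuous_on {0..t} (\<lambda>s. max 0 (y s - c))"
    using t by (intro continuous_intros continuous_on_subset[OF y]) auto
  then obtain s where s: "s \<in> {0..t}" "\<And>u. u \<in> {0..t} \<Longrightarrow> max 0 (y u - c) \<le> max 0 (y s - c)"
    using continuous_attains_sup[of "{0..t}" "\<lambda>s. max 0 (y s - c)"] t by auto
  have eq: "regulator c y t = max 0 (y s - c)"
    unfolding regulator_def by (rule cSup_eq_maximum) (use s in auto)
  show "\<exists>s\<in>{0..t}. regulator c y t = max 0 (y s - c)" using s eq by blast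
  show "s \<in> {0..t} \<Longrightarrow> max 0 (y s - c) \<le> regulator c y t" for s using s eq by simp
qed

lemma regulator_nonneg:
  assumes "continuous_on {0..T} y" "t \<in> {0..T}"
  shows "0 \<le> regulator c y t"
  using regulator_attained[OF assms, of c] by auto

lemma regulator_mono:
  assumes y: "continuous_on {0..T} y" and st: "0 \<le> s" "s \<le> t" "t \<le> T"
  shows "regulator c y s \<le> regulator c y t"
  using regulator_attained[OF y, of s c] regulator_ge[OF y, of t _ c] st by force

lemma regulator_0: "y 0 \<le> c \<Longrightarrow> regulator c y 0 = 0"
  by (simp add: regulator_def)

text \<open>A larger maximum at \<open>t\<close> cannot be attained by time \<open>s\<close>, and
  being positive it is not the 0 in \<open>max\<close>. At the attaining time \<open>u\<close> the
  reflected path equals \<open>c\<close>; this replaces any differentiation of the regulator in what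
  follows.\<close>

lemma regulator_increase:
  assumes y: "continuous_on {0..T} y" and st: "0 \<le> s" "s \<le> t" "t \<le> T"
    and less: "regulator c y s < regulator c y t"
  obtains u where "u \<in> {s<..t}" "regulator c y t = y u - c"
proof -
  obtain u where u: "u \<in> {0..t}" "regulator c y t = max 0 (y u - c)"
    using regulator_attained[OF y, of t c] st by auto
  have "u > s"
    using regulator_ge[OF y, of s u c] u st less by fastforce
  moreover have "0 \<le> regulator c y s" using regulator_nonneg[OF y, of s] st by simp
  ultimately show ?thesis using u less by (intro that[of u]) (auto simp: max_def split: if_splits)
qed

lemma regulator_lipschitz:
  assumes y: "continuous_on {0..T} y" and y': "continuous_on {0..T} y'" and t: "t \<in> {0..T}"
    and le: "\<And>s. s \<in> {0..t} \<Longrightarrow> \<bar>y s - y' s\<bar> \<le> e"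
  shows "\<bar>regulator c y t - regulator c y' t\<bar> \<le> e"
proof -
  obtain s where s: "s \<in> {0..t}" "regulator c y t = max 0 (y s - c)" using regulator_attained[OF y t] by blast
  obtain s' where s': "s' \<in> {0..t}" "regulator c y' t = max 0 (y' s' - c)" using regulator_attained[OF y' t] by blast
  show ?thesis
    using regulator_ge[OF y t s'(1), of c] regulator_ge[OF y' t s(1), of c] le[OF s(1)] le[OF s'(1)] s(2) s'(2)
    by linarith
qed

lemma continuous_on_regulator:
  assumes y: "continuous_on {0..T} y"
  shows "continuous_on {0..T} (regulator c y)"
  unfolding continuous_on_iff
proof (intro ballI allI impI)
  fix x e :: real assume x: "x \<in> {0..T}" "0 < e"
  have "uniformly_continuous_on {0..T} y"
    using compact_uniformly_continuous[OF y] by simp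
  then obtain d where d: "d > 0" "\<And>u v. u \<in> {0..T} \<Longrightarrow> v \<in> {0..T} \<Longrightarrow> dist v u < d \<Longrightarrow> dist (y v) (y u) < e"
    unfolding uniformly_continuous_on_def using x(2) by metis
  have inc: "\<bar>regulator c y t - regulator c y s\<bar> < e" if st: "0 \<le> s" "s \<le> t" "t \<le> T" "t - s < d" for s t
  proof (cases "regulator c y s < regulator c y t")
    case True
    then obtain u where u: "u \<in> {s<..t}" "regulator c y t = y u - c"
      using regulator_increase[OF y st(1-3)] by blast
    have "y s - c \<le> regulator c y s" using regulator_ge[OF y, of s s c] st by auto
    moreover have "dist (y u) (y s) < e" using u st by (intro d(2)) (auto simp: dist_real_def)
    ultimately show ?thesis using True u by (auto simp: dist_real_def)
  next
    case False
    then show ?thesis using regulator_mono[OF y st(1-3), of c] x(2) by simp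
  qed
  have "dist (regulator c y z) (regulator c y x) < e" if z: "z \<in> {0..T}" "dist z x < d" for z
    using inc[of x z] inc[of z x] z x by (cases "x \<le> z") (auto simp: dist_real_def abs_minus_commute)
  with d(1) show "\<exists>d>0. \<forall>z\<in>{0..T}. dist z x < d \<longrightarrow> dist (regulator c y z) (regulator c y x) < e" by blast
qed

text \<open>One inequality is minimality of the running maximum. For the other, go back from
  \<open>t\<close> to the last contact time \<open>s\<close>, where
  \<open>y s - cumul l s = c\<close>: \<open>l\<close> vanishes almost everywhere after
  \<open>s\<close>, so \<open>cumul l t = y s - c\<close>. Without any contact
  \<open>cumul l t = 0\<close>.\<close>

lemma regulator_unique:
  assumes y: "continuous_on {0..T} y" and l: "set_integrable lborel {0..T} l"
    and nn: "AE u\<in>{0..T} in lborel. 0 \<le> l u"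
    and le: "\<And>s. s \<in> {0..T} \<Longrightarrow> y s - cumul l s \<le> c"
    and flat: "AE u\<in>{0..T} in lborel. y u - cumul l u < c \<longrightarrow> l u = 0"
    and t: "t \<in> {0..T}"
  shows "cumul l t = regulator c y t"
proof (rule antisym)
  have mono: "cumul l s \<le> cumul l t" if "0 \<le> s" "s \<le> t" for s
    using cumul_mono[OF l nn that] t by simp
  have nonneg: "0 \<le> cumul l t" using mono[of 0] t by simp
  show "regulator c y t \<le> cumul l t"
    using regulator_attained[OF y t, of c] mono nonneg le t by force
  define Z where "Z = {s \<in> {0..t}. y s - cumul l s = c}"
  have flat_on: "cumul l s = cumul l t" if s: "0 \<le> s" "s \<le> t" "\<And>u. u \<in> {s<..t} \<Longrightarrow> u \<notin> Z" for s
  proof -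
    have "(LINT u:{s<..t}|lborel. l u) = (LINT u|(lborel :: real measure). 0)"
      unfolding set_lebesgue_integral_def
    proof (rule integral_cong_AE)
      show "(\<lambda>u. indicat_real {s<..t} u *\<^sub>R l u) \<in> borel_measurable lborel"
      proof -
        have "{s<..t} \<subseteq> {0..T}" using s(1) t by auto
        from set_integrable_Icc_subset[OF l _ this] show ?thesis by (simp add: set_integrable_def)
      qed
      show "AE u in lborel. indicat_real {s<..t} u *\<^sub>R l u = 0"
        using flat
      proof eventually_elim
        case (elim u)
        then show ?case using s t le[of u] by (cases "u \<in> {s<..t}") (force simp: Z_def)+
      qed
    qed simp
    then show ?thesis using cumul_diff[OF l s(1,2)] t by simp
  qed
  show "cumul l t \<le> regulator c y t"
  proof (cases "Z = {}")
    case True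
    then have "cumul l t = 0" using flat_on[of 0] t by simp
    then show ?thesis using regulator_nonneg[OF y t] by simp
  next
    case False
    have "continuous_on {0..t} (\<lambda>s. y s - cumul l s)"
      using t by (intro continuous_intros continuous_on_subset[OF y] continuous_on_subset[OF continuous_on_cumul[OF l]]) auto
    then have "closed Z" unfolding Z_def by (rule continuous_closed_preimage_constant) simp
    then have "compact Z" unfolding Z_def
      by (metis (no_types, lifting) bounded_closed_interval bounded_subset compact_eq_bounded_closed mem_Collect_eq subsetI)
    then obtain s where s: "s \<in> Z" "\<And>u. u \<in> Z \<Longrightarrow> u \<le> s"
      using compact_attains_sup[of Z] False by blast
    have "s \<in> {0..t}" using s(1) by (simp add: Z_def)
    moreover have "u \<notin> Z" if "u \<in> {s<..t}" for u using s(2)[of u] that by auto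
    ultimately have "cumul l t = cumul l s" using flat_on[of s] by simp
    also have "\<dots> = y s - c" using s(1) by (simp add: Z_def)
    also have "\<dots> \<le> regulator c y t" using regulator_ge[OF y t, of s c] s(1) by (simp add: Z_def)
    finally show ?thesis .
  qed
qed

section \<open>The departure map\<close>

text \<open>Here the distributions are present only through their densities \<open>g\<close> and
  \<open>f\<close>; \<open>c\<close> stands for the total capacity \<open>1 + \<beta>\<close> per
  server and \<open>C\<close> for the bound on the service density.\<close>

locale fluid_queue =
  fixes T r0 c C :: real and lam g f :: "real \<Rightarrow> real"
  assumes T: "0 < T"
    and lam: "set_integrable lborel {0..T} lam" "\<And>u. 0 \<le> u \<Longrightarrow> 0 \<le> lam u"
    and g: "g \<in> borel_measurable borel" "\<And>w. 0 \<le> g w" "\<And>w. g w \<le> C" "0 < C"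
    and f: "set_integrable lborel {0..T} f" "mono_on {0..T} (cumul f)"
    and r0: "0 < r0" "r0 \<le> c" and c: "1 \<le> c"
begin

text \<open>If \<open>D\<close> is the departure process, then \<open>level D\<close> is \<open>\<rho> + \<eta>\<close> and \<open>entered D\<close> counts the fluid that
  went into service after time 0.\<close>

definition "netput D t = r0 + cumul lam t - D t" for D t
definition "level D t = netput D t - regulator c (netput D) t" for D t
definition "entered D t = min (level D t) 1 - min r0 1 + D t" for D t
definition "departures D t = min r0 1 * cumul f t + conv g (entered D) t" for D t

context
  fixes D :: "real \<Rightarrow> real" assumes D: "continuous_on {0..T} D"
begin

lemma continuous_on_netput: "continuous_on {0..T} (netput D)"
  unfolding netput_def[abs_def]
  by (intro continuous_intros D continuous_on_cumul lam)

lemma continuous_on_level: "continuous_on {0..T} (level D)"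
  unfolding level_def[abs_def]
  by (intro continuous_intros continuous_on_netput continuous_on_regulator)

lemma continuous_on_entered: "continuous_on {0..T} (entered D)"
  unfolding entered_def[abs_def]
  by (intro continuous_intros continuous_on_level D)

lemma level_le: "t \<in> {0..T} \<Longrightarrow> level D t \<le> c"
  using regulator_ge[OF continuous_on_netput, of t t c] by (simp add: level_def)

lemma level_0: "D 0 = 0 \<Longrightarrow> level D 0 = r0"
  using r0 by (simp add: level_def regulator_0 netput_def)

lemma entered_0: "D 0 = 0 \<Longrightarrow> entered D 0 = 0"
  by (simp add: entered_def level_0)

lemma departures_0: "D 0 = 0 \<Longrightarrow> departures D 0 = 0"
proof -
  have "conv g (entered D) 0 = cumul (\<lambda>w. g w * entered D (0 - w)) 0"
    by (simp add: conv_def cumul_def)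
  then show "departures D 0 = 0" by (simp add: departures_def)
qed

end

lemma cumul_lam_mono: "0 \<le> s \<Longrightarrow> s \<le> t \<Longrightarrow> t \<le> T \<Longrightarrow> cumul lam s \<le> cumul lam t"
  by (rule cumul_mono[OF lam(1)]) (use lam in auto)

text \<open>If the level at \<open>t\<close> is at least 1, the minimum has its largest value and
  \<open>D\<close> grows. If it is below 1, \<open>D\<close> cancels and \<open>entered D t\<close>
  is cumulative arrivals minus the regulator, up to a constant; only growth of the regulator could
  then spoil monotonicity. This is what keeps the Picard iterates nondecreasing in time.\<close>

lemma entered_mono:
  assumes D: "continuous_on {0..T} D" "mono_on {0..T} D"
  shows "mono_on {0..T} (entered D)"
proof (rule mono_onI)
  fix s t assume st: "s \<in> {0..T}" "t \<in> {0..T}" "s \<le> t"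
  have Dm: "D u \<le> D v" if "0 \<le> u" "u \<le> v" "v \<le> T" for u v
    using mono_onD[OF D(2), of u v] that by auto
  let ?L = "regulator c (netput D)"
  show "entered D s \<le> entered D t"
  proof (cases "level D t \<ge> 1")
    case True
    then show ?thesis using Dm[of s t] st by (auto simp: entered_def)
  next
    case False
    note y = continuous_on_netput[OF D(1)]
    \<comment> \<open>if the regulator grows on \<open>[s, t]\<close>, compare through a time after which it is constant, where the level is \<open>c\<close>\<close>
    have flat: "entered D u \<le> entered D t" if "?L u = ?L t" "0 \<le> u" "u \<le> t" for u
      using that cumul_lam_mono[of u t] Dm[of u t] st False
      by (auto simp: entered_def level_def netput_def min_def)
    show ?thesis
    proof (cases "?L s < ?L t")
      case True
      then obtain u where u: "u \<in> {s<..t}" "?L t = netput D u - c"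
        using regulator_increase[OF y] st by (metis atLeastAtMost_iff)
      have "?L u \<le> ?L t" using regulator_mono[OF y, of u t c] u st by auto
      moreover have "netput D u - c \<le> ?L u" using regulator_ge[OF y, of u u c] u st by auto
      ultimately have Lu: "?L u = ?L t" "level D u = c" using u by (auto simp: level_def)
      have "entered D s \<le> entered D u"
        using Lu(2) c Dm[of s u] u st by (auto simp: entered_def)
      also have "\<dots> \<le> entered D t" using flat[of u] Lu u st by auto
      finally show ?thesis .
    next
      case False
      then show ?thesis using flat[of s] regulator_mono[OF y, of s t c] st by auto
    qed
  qed
qed

lemma
  assumes D: "continuous_on {0..T} D" "mono_on {0..T} D" "D 0 = 0"
  shows departures_mono: "mono_on {0..T} (departures D)"
    and departures_increment: "\<And>s t. 0 \<le> s \<Longrightarrow> s \<le> t \<Longrightarrow> t \<le> T \<Longrightarrow>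
      departures D t - departures D s \<le>
        cumul (\<lambda>u. min r0 1 * max 0 (f u) + C * entered D T) t - cumul (\<lambda>u. min r0 1 * max 0 (f u) + C * entered D T) s"
    and continuous_on_departures: "continuous_on {0..T} (departures D)"
proof -
  note A = continuous_on_entered[OF D(1)] entered_mono[OF D(1,2)] entered_0[OF D(1,3), THEN eq_refl[OF sym]]
  have r: "0 \<le> min r0 1" using r0 by simp
  show mono: "mono_on {0..T} (departures D)"
  proof (rule mono_onI)
    fix s t assume st: "s \<in> {0..T}" "t \<in> {0..T}" "s \<le> t"
    have "min r0 1 * cumul f s \<le> min r0 1 * cumul f t"
      using mono_onD[OF f(2), of s t] st r by (intro mult_left_mono) auto
    moreover have "conv g (entered D) s \<le> conv g (entered D) t"
      using st by (intro conv_mono[OF g(1-3) A]) auto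
    ultimately show "departures D s \<le> departures D t" by (simp add: departures_def)
  qed
  \<comment> \<open>\<open>f\<close> is nonnegative only almost everywhere. Its positive part has
    the same primitive and is nonnegative at every point, as the dominating function in
    \<open>density_exists\<close> must be.\<close>
  have fp: "set_integrable lborel {0..T} (\<lambda>u. max 0 (f u))" by (rule set_integrable_pos_part[OF f(1)])
  have "AE u\<in>{0..T} in lborel. 0 \<le> f u" by (rule AE_nonneg_of_cumul_mono[OF f(1) _ f(2)]) (use T in simp)
  then have "AE u\<in>{0..T} in lborel. f u = max 0 (f u)" by eventually_elim auto
  note f_eq = cumul_cong_AE[OF f(1) fp this]
  let ?h = "\<lambda>u. min r0 1 * max 0 (f u) + C * entered D T"
  have cst: "set_integrable lborel {0..T} (\<lambda>u. C * entered D T)"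
    by (intro borel_integrable_atLeastAtMost' continuous_intros)
  have h: "set_integrable lborel {0..T} ?h"
    using fp cst by auto
  have cum_h: "cumul ?h t = min r0 1 * cumul f t + C * entered D T * t" if "t \<in> {0..T}" for t
  proof -
    have "cumul ?h t = cumul (\<lambda>u. min r0 1 * max 0 (f u)) t + cumul (\<lambda>u. C * entered D T) t"
      by (rule cumul_add) (use fp cst that in auto)
    also have "cumul (\<lambda>u. C * entered D T) t = C * entered D T * t"
      using that by (simp add: cumul_def set_integral_const)
    finally show ?thesis using f_eq[of t] that by (simp add: cumul_cmult)
  qed
  show inc: "departures D t - departures D s \<le> cumul ?h t - cumul ?h s" if st: "0 \<le> s" "s \<le> t" "t \<le> T" for s t
    using conv_increment_le[OF g(1-3) A st] cum_h[of s] cum_h[of t] st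
    by (simp add: departures_def algebra_simps)
  show "continuous_on {0..T} (departures D)"
  proof (rule continuous_on_dominated_increments[OF continuous_on_cumul[OF h]])
    fix s t assume st: "0 \<le> s" "s \<le> t" "t \<le> T"
    then have "departures D s \<le> departures D t" using mono_onD[OF mono, of s t] by auto
    with inc[OF st] show "\<bar>departures D t - departures D s\<bar> \<le> \<bar>cumul ?h t - cumul ?h s\<bar>" by linarith
  qed
qed

section \<open>Contraction estimate and Picard iteration\<close>

lemma cumul_exp:
  assumes "0 < (a::real)" "0 \<le> t"
  shows "cumul (\<lambda>u. exp (a * u)) t = (exp (a * t) - 1) / a"
proof -
  have "((\<lambda>u. exp (a * u)) has_integral exp (a * t) / a - exp (a * 0) / a) {0..t}"
    using assms
    by (intro fundamental_theorem_of_calculus)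
       (auto simp flip: has_real_derivative_iff_has_vector_derivative intro!: derivative_eq_intros)
  moreover have "set_integrable lborel {0..t} (\<lambda>u. exp (a * u))"
    by (intro borel_integrable_atLeastAtMost' continuous_intros)
  ultimately show ?thesis
    unfolding cumul_def by (simp add: set_borel_integral_eq_integral(2) integral_unique diff_divide_distrib)
qed

text \<open>Contraction with factor 1/2 in the supremum norm weighted by \<open>exp (- 6 * C * t)\<close>.\<close>

lemma departures_contraction:
  assumes D: "continuous_on {0..T} D" and D': "continuous_on {0..T} D'"
    and le: "\<And>t. t \<in> {0..T} \<Longrightarrow> \<bar>D t - D' t\<bar> \<le> N * exp (6 * C * t)"
    and t: "t \<in> {0..T}"
  shows "\<bar>departures D t - departures D' t\<bar> \<le> N / 2 * exp (6 * C * t)"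
proof -
  have N: "0 \<le> N" using le[of 0] T by (simp add: order_trans[OF abs_ge_zero])
  \<comment> \<open>The 3 counts the occurrences of \<open>D\<close> in \<open>entered\<close>: the
    explicit summand, the one in \<open>netput\<close>, and the one in the regulator. The regulator
    looks at all earlier times, which costs nothing because the weight is increasing.\<close>
  have E: "\<bar>entered D v - entered D' v\<bar> \<le> 3 * N * exp (6 * C * v)" if v: "v \<in> {0..T}" for v
  proof -
    have "\<bar>regulator c (netput D) v - regulator c (netput D') v\<bar> \<le> N * exp (6 * C * v)"
    proof (rule regulator_lipschitz[OF continuous_on_netput[OF D] continuous_on_netput[OF D'] v])
      fix s assume s: "s \<in> {0..v}"
      have "\<bar>netput D s - netput D' s\<bar> \<le> N * exp (6 * C * s)" using le[of s] s v by (auto simp: netput_def)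
      also have "\<dots> \<le> N * exp (6 * C * v)" using s g N by (intro mult_left_mono) auto
      finally show "\<bar>netput D s - netput D' s\<bar> \<le> N * exp (6 * C * v)" .
    qed
    with le[OF v] show ?thesis
      unfolding entered_def level_def netput_def by (simp add: min_def abs_le_iff)
  qed
  have abs_g_le: "\<bar>g w\<bar> \<le> C" for w using g by simp
  note i = set_integrable_conv[OF g(1) abs_g_le continuous_on_entered[OF D], of t]
    set_integrable_conv[OF g(1) abs_g_le continuous_on_entered[OF D'], of t]
  have eq: "departures D t - departures D' t = (LINT w:{0..t}|lborel. g w * entered D (t - w) - g w * entered D' (t - w))"
    using t by (subst set_integral_diff(2)[OF i]) (auto simp: departures_def conv_def)
  have "\<bar>departures D t - departures D' t\<bar> \<le> (LINT w:{0..t}|lborel. (3 * C * N) * exp (6 * C * (t - w)))"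
  proof -
    have j: "set_integrable lborel {0..t} (\<lambda>w. \<bar>g w * entered D (t - w) - g w * entered D' (t - w)\<bar>)"
      using t by (intro set_integrable_abs set_integral_diff(1) i) auto
    have "\<bar>LINT w:{0..t}|lborel. g w * entered D (t - w) - g w * entered D' (t - w)\<bar>
        \<le> (LINT w:{0..t}|lborel. \<bar>g w * entered D (t - w) - g w * entered D' (t - w)\<bar>)"
      unfolding set_lebesgue_integral_def
      by (rule order_trans[OF integral_abs_bound]) (simp add: abs_mult)
    also have "\<dots> \<le> (LINT w:{0..t}|lborel. (3 * C * N) * exp (6 * C * (t - w)))"
    proof (rule set_integral_mono[OF j])
      show "set_integrable lborel {0..t} (\<lambda>w. (3 * C * N) * exp (6 * C * (t - w)))"
        by (intro borel_integrable_atLeastAtMost' continuous_intros)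
      fix w assume w: "w \<in> {0..t}"
      have "\<bar>g w * entered D (t - w) - g w * entered D' (t - w)\<bar> = g w * \<bar>entered D (t - w) - entered D' (t - w)\<bar>"
        using g(2)[of w] by (simp add: abs_mult flip: right_diff_distrib)
      also have "\<dots> \<le> C * (3 * N * exp (6 * C * (t - w)))"
        using g w t by (intro mult_mono E) auto
      finally show "\<bar>g w * entered D (t - w) - g w * entered D' (t - w)\<bar> \<le> (3 * C * N) * exp (6 * C * (t - w))"
        by (simp add: mult_ac)
    qed
    finally show ?thesis unfolding eq .
  qed
  also have "\<dots> = (3 * C * N) * conv (\<lambda>_. 1) (\<lambda>v. exp (6 * C * v)) t"
    by (simp only: conv_def set_integral_mult_right mult_1)
  \<comment> \<open>The rate \<open>6 * C\<close> is chosen so that \<open>3 * C / (6 * C)\<close>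
    is the contraction factor.\<close>
  also have "\<dots> = N / 2 * (exp (6 * C * t) - 1)"
  proof -
    have "conv (\<lambda>_. 1) (\<lambda>v. exp (6 * C * v)) t = (exp (6 * C * t) - 1) / (6 * C)"
      unfolding conv_one using g(4) t by (intro cumul_exp) auto
    then show ?thesis using g(4) by simp
  qed
  also have "\<dots> \<le> N / 2 * exp (6 * C * t)" using N by (intro mult_left_mono) auto
  finally show ?thesis .
qed

lemma fixpoint_unique:
  assumes D: "continuous_on {0..T} D" and D': "continuous_on {0..T} D'"
    and fp: "\<And>t. t \<in> {0..T} \<Longrightarrow> departures D t = D t" "\<And>t. t \<in> {0..T} \<Longrightarrow> departures D' t = D' t"
    and t: "t \<in> {0..T}"
  shows "D t = D' t"
proof -
  obtain N where N: "\<And>u. u \<in> {0..T} \<Longrightarrow> \<bar>D u - D' u\<bar> \<le> N"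
    using continuous_on_Icc_bounded[OF continuous_on_diff[OF D D']] by blast
  have N0: "0 \<le> N" using N[of 0] T by (simp add: order_trans[OF abs_ge_zero])
  have bound: "\<forall>u\<in>{0..T}. \<bar>D u - D' u\<bar> \<le> N * (1/2)^n * exp (6 * C * u)" for n
  proof (induction n)
    case 0
    show ?case
    proof
      fix u assume u: "u \<in> {0..T}"
      then have "N * 1 \<le> N * exp (6 * C * u)" using g N0 by (intro mult_left_mono) auto
      with N[OF u] show "\<bar>D u - D' u\<bar> \<le> N * (1/2)^0 * exp (6 * C * u)" by simp
    qed
  next
    case (Suc n)
    show ?case
    proof
      fix u assume u: "u \<in> {0..T}"
      have "\<bar>departures D u - departures D' u\<bar> \<le> N * (1/2)^n / 2 * exp (6 * C * u)"
        by (rule departures_contraction[OF D D' _ u]) (use Suc in blast)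
      then show "\<bar>D u - D' u\<bar> \<le> N * (1/2)^Suc n * exp (6 * C * u)" using fp u by simp
    qed
  qed
  have "(\<lambda>n. N * (1/2)^n * exp (6 * C * t)) \<longlonglongrightarrow> N * 0 * exp (6 * C * t)"
    by (intro tendsto_intros LIMSEQ_power_zero) auto
  then have "\<bar>D t - D' t\<bar> \<le> N * 0 * exp (6 * C * t)"
    by (rule LIMSEQ_le_const) (use bound t in blast)
  then show ?thesis by simp
qed

text \<open>The iteration starts from 0. Monotonicity in \<open>t\<close>, not in the iteration
  index, is carried along: it passes to the limit and later yields the density.\<close>

lemma fixpoint_exists:
  obtains D where "continuous_on {0..T} D" "mono_on {0..T} D" "D 0 = 0"
    "\<And>t. t \<in> {0..T} \<Longrightarrow> departures D t = D t"
proof -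
  define S where "S n = (departures ^^ n) (\<lambda>_. 0)" for n
  have S_Suc: "S (Suc n) = departures (S n)" for n by (simp add: S_def)
  have S: "continuous_on {0..T} (S n) \<and> mono_on {0..T} (S n) \<and> S n 0 = 0" for n
  proof (induction n)
    case 0 show ?case by (auto simp: S_def intro: mono_onI)
  next
    case (Suc n)
    then show ?case unfolding S_Suc
      using departures_mono continuous_on_departures departures_0 by blast
  qed
  obtain N where N: "\<And>u. u \<in> {0..T} \<Longrightarrow> \<bar>S 1 u - S 0 u\<bar> \<le> N"
  proof -
    have "continuous_on {0..T} (\<lambda>u. S 1 u - S 0 u)" using S by (intro continuous_on_diff) auto
    then show ?thesis using continuous_on_Icc_bounded that by blast
  qed
  have N0: "0 \<le> N" using N[of 0] T by (simp add: order_trans[OF abs_ge_zero])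
  have bound: "\<forall>u\<in>{0..T}. \<bar>S (Suc n) u - S n u\<bar> \<le> N * (1/2)^n * exp (6 * C * u)" for n
  proof (induction n)
    case 0
    show ?case
    proof
      fix u assume u: "u \<in> {0..T}"
      then have "N * 1 \<le> N * exp (6 * C * u)" using g N0 by (intro mult_left_mono) auto
      with N[OF u] show "\<bar>S (Suc 0) u - S 0 u\<bar> \<le> N * (1/2)^0 * exp (6 * C * u)" by simp
    qed
  next
    case (Suc n)
    show ?case
    proof
      fix u assume u: "u \<in> {0..T}"
      have "\<bar>departures (S (Suc n)) u - departures (S n) u\<bar> \<le> N * (1/2)^n / 2 * exp (6 * C * u)"
        by (rule departures_contraction[OF _ _ _ u]) (use Suc S in blast)+
      then show "\<bar>S (Suc (Suc n)) u - S (Suc n) u\<bar> \<le> N * (1/2)^Suc n * exp (6 * C * u)"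
        by (simp add: S_Suc)
    qed
  qed
  \<comment> \<open>The limit is written as a telescoping series so that the geometric bound gives
    uniform convergence by the Weierstrass test.\<close>
  define D where "D u = (\<Sum>n. S (Suc n) u - S n u)" for u
  have "uniform_limit {0..T} (\<lambda>n u. \<Sum>i<n. S (Suc i) u - S i u) D sequentially"
    unfolding D_def[abs_def]
  proof (rule Weierstrass_m_test)
    show "summable (\<lambda>n. N * (1/2)^n * exp (6 * C * T))"
      by (intro summable_mult summable_mult2 summable_geometric) auto
    fix n u assume u: "u \<in> {0..T}"
    have "norm (S (Suc n) u - S n u) \<le> N * (1/2)^n * exp (6 * C * u)" using bound u by simp
    also have "\<dots> \<le> N * (1/2)^n * exp (6 * C * T)" using u N0 g by (intro mult_left_mono) auto
    finally show "norm (S (Suc n) u - S n u) \<le> N * (1/2)^n * exp (6 * C * T)" .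
  qed
  moreover have "(\<Sum>i<n. S (Suc i) u - S i u) = S n u" for n u
    by (subst sum_lessThan_telescope) (simp add: S_def)
  ultimately have lim: "uniform_limit {0..T} S D sequentially" by simp
  have ptw: "(\<lambda>n. S n u) \<longlonglongrightarrow> D u" if "u \<in> {0..T}" for u
    using tendsto_uniform_limitI[OF lim that] .
  have contD: "continuous_on {0..T} D"
    by (rule uniform_limit_theorem[OF _ lim]) (use S in auto)
  have monoD: "mono_on {0..T} D"
  proof (rule mono_onI)
    fix s t assume st: "s \<in> {0..T}" "t \<in> {0..T}" "s \<le> t"
    show "D s \<le> D t"
      by (rule LIMSEQ_le[OF ptw[OF st(1)] ptw[OF st(2)]]) (use S mono_onD st in blast)
  qed
  have D0: "D 0 = 0" using LIMSEQ_unique[OF ptw[of 0]] S T by auto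
  have fp: "departures D t = D t" if t: "t \<in> {0..T}" for t
  proof -
    have "\<bar>departures D t - D t\<bar> \<le> 0"
    proof (rule field_le_epsilon)
      fix e :: real assume e: "e > 0"
      \<comment> \<open>One \<open>e'\<close> is the distance of the next iterate from
        \<open>D\<close>; \<open>e' * exp (6 * C * T)\<close> covers the image under
        \<open>departures\<close> of the distance of the current one.\<close>
      define e' where "e' = e / (1 + exp (6 * C * T))"
      have e': "e' > 0" "e' * (1 + exp (6 * C * T)) = e"
        unfolding e'_def using e by (auto simp: add_pos_pos less_imp_neq[THEN not_sym])
      have "\<forall>\<^sub>F n in sequentially. \<forall>u\<in>{0..T}. dist (S n u) (D u) < e'"
        using uniform_limitD[OF lim e'(1)] .
      then obtain n where n: "\<And>m u. m \<ge> n \<Longrightarrow> u \<in> {0..T} \<Longrightarrow> \<bar>S m u - D u\<bar> < e'"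
        unfolding eventually_sequentially dist_real_def by blast
      have "\<bar>departures D t - departures (S n) t\<bar> \<le> e' / 2 * exp (6 * C * t)"
      proof (rule departures_contraction[OF contD _ _ t])
        fix u assume u: "u \<in> {0..T}"
        then have "e' * 1 \<le> e' * exp (6 * C * u)" using g e' by (intro mult_left_mono) auto
        with n[of n u] u show "\<bar>D u - S n u\<bar> \<le> e' * exp (6 * C * u)" by (simp add: abs_minus_commute)
      qed (use S in auto)
      also have "\<dots> \<le> e' * exp (6 * C * T)" using t g e' by (intro mult_mono) auto
      finally have "\<bar>departures D t - S (Suc n) t\<bar> \<le> e' * exp (6 * C * T)" by (simp add: S_Suc)
      moreover have "\<bar>S (Suc n) t - D t\<bar> < e'" using n[of "Suc n" t] t by simp
      ultimately show "\<bar>departures D t - D t\<bar> \<le> 0 + e" using e'(2) by (simp add: algebra_simps)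
    qed
    then show ?thesis by simp
  qed
  show ?thesis using that[OF contD monoD D0 fp] .
qed

end

section \<open>Existence and uniqueness of the fluid solution\<close>

text \<open>\<open>fluid_solution\<close> imposes the state constraints only almost everywhere,
  while \<open>regulator_unique\<close> needs the upper bound at every time; continuity closes the
  gap.\<close>

lemma le_on_Icc_of_AE_le:
  fixes h k :: "real \<Rightarrow> real"
  assumes h: "continuous_on {0..T} h" and k: "continuous_on {0..T} k" and T: "0 < T"
    and ae: "AE u\<in>{0..T} in lborel. h u \<le> k u" and t: "t \<in> {0..T}"
  shows "h t \<le> k t"
proof (rule ccontr)
  assume "\<not> h t \<le> k t"
  then have pos: "h t - k t > 0" by simp
  have "continuous_on {0..T} (\<lambda>u. h u - k u)" by (intro continuous_on_diff h k)
  then obtain d where d: "d > 0" "\<And>u. u \<in> {0..T} \<Longrightarrow> dist u t < d \<Longrightarrow> dist (h u - k u) (h t - k t) < h t - k t"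
    unfolding continuous_on_iff using t pos by blast
  \<comment> \<open>Cutting the neighbourhood to \<open>{0..T}\<close> leaves an interval of
    positive length even when \<open>t\<close> is an endpoint, since \<open>0 < T\<close>.\<close>
  define a where "a = max 0 (t - d/2)"
  define b where "b = min T (t + d/2)"
  have ab: "a < b" using T t d(1) by (auto simp: a_def b_def)
  have "AE u in lborel. u \<notin> {a..b}"
    using ae
  proof eventually_elim
    case (elim u)
    show ?case
    proof
      assume u: "u \<in> {a..b}"
      then have "u \<in> {0..T}" "dist u t < d" using d(1) by (auto simp: a_def b_def dist_real_def)
      with d(2)[of u] elim show False by (auto simp: dist_real_def abs_less_iff)
    qed
  qed
  then have "{a..b} \<in> null_sets lborel" by (subst AE_iff_null_sets) auto
  then have "emeasure lborel {a..b} = 0" by auto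
  with ab show False by simp
qed

text \<open>That the regulator is locally constant where the path is below \<open>c\<close> must be
  transferred to its density. The indicator of \<open>?x u < c\<close> does not localize at contact
  points; lowering the threshold by \<open>e\<close> makes it vanish near them, so that every point
  has a harmless neighbourhood.\<close>

lemma regulator_density_flat:
  assumes y: "continuous_on {0..T} y" and l: "set_integrable lborel {0..T} l" "\<And>u. 0 \<le> l u"
    and L: "\<And>t. t \<in> {0..T} \<Longrightarrow> regulator c y t = cumul l t" and T: "0 \<le> T"
  shows "AE u\<in>{0..T} in lborel. y u - regulator c y u < c \<longrightarrow> l u = 0"
proof -
  let ?x = "\<lambda>u. y u - regulator c y u"
  have contx: "continuous_on {0..T} ?x" by (intro continuous_on_diff y continuous_on_regulator)
  \<comment> \<open>near a point with \<open>?x < c\<close> the regulator is constant, near any other point \<open>?x > c - e\<close>;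
    the two local statements are combined by bisection\<close>
  have "AE u\<in>{0..T} in lborel. of_bool (?x u < c - e) * l u = 0" if e: "e > 0" for e
  proof -
    let ?k = "\<lambda>u. of_bool (?x u < c - e) * l u"
    have k: "set_integrable lborel {0..T} ?k"
      by (rule set_integrable_mult_bounded[OF l(1), where C = 1])
        (use set_borel_measurable_of_bool_less[OF set_borel_measurable_continuous_on_Icc[OF contx]] in auto)
    have zero: "set_integrable lborel {0..T} (\<lambda>u. 0 :: real)" by (simp add: set_integrable_def)
    define P where "P a b \<longleftrightarrow> (0 \<le> a \<longrightarrow> a \<le> b \<longrightarrow> b \<le> T \<longrightarrow> cumul ?k b = cumul ?k a)" for a b
    have "cumul ?k t = cumul (\<lambda>u. 0) t" if t: "t \<in> {0..T}" for t
    proof -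
      have "0 \<le> t" using t by simp
      then have "P 0 t"
      proof (induction rule: Bolzano)
        case (trans a b c)
        then show ?case by (auto simp: P_def)
      next
        case (local z)
        then have z: "z \<in> {0..T}" using t by auto
        show ?case
        proof (cases "?x z < c")
          case True
          then have "0 < c - ?x z" by simp
          with contx z obtain d where d: "d > 0" "\<And>u. u \<in> {0..T} \<Longrightarrow> dist u z < d \<Longrightarrow> dist (?x u) (?x z) < c - ?x z"
            unfolding continuous_on_iff by blast
          have "P a b" if ab: "a \<le> z" "z \<le> b" "b - a < d" for a b
            unfolding P_def
          proof (intro impI)
            assume A: "0 \<le> a" "a \<le> b" "b \<le> T"
            have "\<not> regulator c y a < regulator c y b"
            proof
              assume "regulator c y a < regulator c y b"
              then obtain u where u: "u \<in> {a<..b}" "regulator c y b = y u - c"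
                using regulator_increase[OF y A] by blast
              have "regulator c y u \<le> regulator c y b" using u A by (intro regulator_mono[OF y]) auto
              then have "c \<le> ?x u" using u by simp
              moreover have "dist (?x u) (?x z) < c - ?x z" using u A ab by (intro d(2)) (auto simp: dist_real_def)
              ultimately show False by (auto simp: dist_real_def)
            qed
            then have "cumul l b \<le> cumul l a" using L[of a] L[of b] A by auto
            moreover have "\<bar>cumul ?k b - cumul ?k a\<bar> \<le> cumul l b - cumul l a"
              by (rule cumul_abs_diff_le[OF k l(1) _ A]) (use l(2) in auto)
            ultimately show "cumul ?k b = cumul ?k a" by simp
          qed
          with d(1) show ?thesis by blast
        next
          case False
          from contx z e obtain d where d: "d > 0" "\<And>u. u \<in> {0..T} \<Longrightarrow> dist u z < d \<Longrightarrow> dist (?x u) (?x z) < e"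
            unfolding continuous_on_iff by blast
          have "P a b" if ab: "a \<le> z" "z \<le> b" "b - a < d" for a b
            unfolding P_def
          proof (intro impI)
            assume A: "0 \<le> a" "a \<le> b" "b \<le> T"
            have "\<bar>cumul ?k b - cumul ?k a\<bar> \<le> cumul (\<lambda>u. 0) b - cumul (\<lambda>u. 0) a"
            proof (rule cumul_abs_diff_le[OF k zero _ A])
              fix u assume "u \<in> {a<..b}"
              then have "dist (?x u) (?x z) < e" using A ab by (intro d(2)) (auto simp: dist_real_def)
              then have "\<not> ?x u < c - e" using False by (auto simp: dist_real_def)
              then show "\<bar>?k u\<bar> \<le> 0" by simp
            qed
            then show "cumul ?k b = cumul ?k a" by (simp add: cumul_def)
          qed
          with d(1) show ?thesis by blast
        qed
      qed
      then show ?thesis using t by (simp add: P_def) (simp add: cumul_def)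
    qed
    from AE_eq_of_cumul_eq[OF k zero T this] show ?thesis .
  qed
  \<comment> \<open>Countably many margins \<open>1 / real (Suc n)\<close> exhaust the set where the
    path is below \<open>c\<close>.\<close>
  then have "AE u in lborel. \<forall>n. u \<in> {0..T} \<longrightarrow> of_bool (?x u < c - 1 / real (Suc n)) * l u = 0"
    by (subst AE_all_countable) auto
  then show ?thesis
  proof eventually_elim
    case (elim u)
    show ?case
    proof (intro impI)
      assume u: "u \<in> {0..T}" "?x u < c"
      then obtain n where "inverse (real (Suc n)) < c - ?x u"
        using reals_Archimedean[of "c - ?x u"] by auto
      then have "?x u < c - 1 / real (Suc n)" by (simp add: inverse_eq_divide)
      with elim u show "l u = 0" by auto
    qed
  qed
qed

section \<open>From solutions to fixed points and back\<close>

locale fluid_queue_distributions = fluid_queue +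
  fixes G F :: "real measure" and \<beta> :: real
  assumes c_eq: "c = 1 + \<beta>"
    and G_cdf: "\<And>v. v \<in> {0..T} \<Longrightarrow> cdf G v = cumul g v" "\<And>v. cdf G v \<le> 1"
    and F_cdf: "\<And>v. v \<in> {0..T} \<Longrightarrow> cdf F v = cumul f v" "\<And>v. cdf F v \<le> 1"
begin

lemma abs_g_le: "\<bar>g w\<bar> \<le> C" using g by simp

lemma g_integrable: "set_integrable lborel {0..T} g"
proof -
  have "set_integrable lborel {0..T} (\<lambda>w. g w * 1)"
  proof (rule set_integrable_mult_bounded)
    show "set_integrable lborel {0..T} (\<lambda>_. 1 :: real)"
      by (intro borel_integrable_atLeastAtMost' continuous_intros)
    show "set_borel_measurable lborel {0..T} g"
      using g(1) unfolding set_borel_measurable_def by measurable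
  qed (use abs_g_le in auto)
  then show ?thesis by simp
qed

text \<open>\<open>z u * b u\<close> is a rate of entry into service. Integration by parts moves the
  density from the entries to \<open>G\<close>, so only the cumulative entries remain.\<close>

lemma
  assumes a: "set_integrable lborel {0..T} (\<lambda>u. z u * b u)" and t: "t \<in> {0..T}"
  shows service_cdf: "(LINT u:{0..t}|lborel. z u * cdf G (t - u) * b u) = conv g (cumul (\<lambda>u. z u * b u)) t"
    and service_tail: "(LINT u:{0..t}|lborel. z u * (1 - cdf G (t - u)) * b u) =
      cumul (\<lambda>u. z u * b u) t - conv g (cumul (\<lambda>u. z u * b u)) t"
proof -
  let ?a = "\<lambda>u. z u * b u"
  have G: "cdf G (t - u) = cumul g (t - u)" if "u \<in> {0..t}" for u using that t by (intro G_cdf) auto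
  have a_t: "set_integrable lborel {0..t} ?a" using t by (auto intro: set_integrable_Icc_subset[OF a])
  have cont: "continuous_on {0..t} (\<lambda>u. cumul g (t - u))"
    by (rule continuous_on_compose2[OF continuous_on_cumul[OF g_integrable]]) (use t in \<open>auto intro!: continuous_intros\<close>)
  obtain N where N: "\<And>u. u \<in> {0..t} \<Longrightarrow> \<bar>cumul g (t - u)\<bar> \<le> N"
    using continuous_on_Icc_bounded[OF cont] by blast
  have i: "set_integrable lborel {0..t} (\<lambda>u. cumul g (t - u) * ?a u)"
    by (rule set_integrable_mult_bounded[OF a_t set_borel_measurable_continuous_on_Icc[OF cont]]) (use N in auto)
  have parts: "(LINT u:{0..t}|lborel. cumul g (t - u) * ?a u) = conv g (cumul ?a) t"
    unfolding conv_def by (rule convolution_by_parts[OF a g_integrable t])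
  show "(LINT u:{0..t}|lborel. z u * cdf G (t - u) * b u) = conv g (cumul ?a) t"
    unfolding parts[symmetric] by (rule set_lebesgue_integral_cong) (auto simp: G)
  have "(LINT u:{0..t}|lborel. z u * (1 - cdf G (t - u)) * b u) = (LINT u:{0..t}|lborel. ?a u - cumul g (t - u) * ?a u)"
    by (rule set_lebesgue_integral_cong) (auto simp: G algebra_simps)
  also have "\<dots> = cumul ?a t - conv g (cumul ?a) t"
    using set_integral_diff(2)[OF a_t i] parts by (simp add: cumul_def)
  finally show "(LINT u:{0..t}|lborel. z u * (1 - cdf G (t - u)) * b u) = cumul ?a t - conv g (cumul ?a) t" .
qed

lemma conv_cumul_add:
  assumes a: "set_integrable lborel {0..T} a" and b: "set_integrable lborel {0..T} b"
    and A: "\<And>v. v \<in> {0..T} \<Longrightarrow> A v = cumul a v + cumul b v" and t: "t \<in> {0..T}"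
  shows "conv g A t = conv g (cumul a) t + conv g (cumul b) t"
proof -
  have t': "t \<le> T" using t by simp
  note i = set_integrable_conv[OF g(1) abs_g_le continuous_on_cumul[OF a] t'] set_integrable_conv[OF g(1) abs_g_le continuous_on_cumul[OF b] t']
  have "conv g A t = (LINT w:{0..t}|lborel. g w * cumul a (t - w) + g w * cumul b (t - w))"
    unfolding conv_def
    by (rule set_lebesgue_integral_cong) (use t in \<open>auto simp: A algebra_simps\<close>)
  also have "\<dots> = conv g (cumul a) t + conv g (cumul b) t"
    unfolding conv_def by (rule set_integral_add(2)[OF i])
  finally show ?thesis .
qed

lemma fluid_solution_imp_fixpoint:
  assumes "fluid_solution T lam G F \<beta> r0 \<rho> \<eta> d"
  shows "set_integrable lborel {0..T} d"
    and "\<And>t. t \<in> {0..T} \<Longrightarrow> departures (cumul d) t = cumul d t"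
    and "\<And>t. t \<in> {0..T} \<Longrightarrow> \<rho> t = min (level (cumul d) t) 1"
    and "\<And>t. t \<in> {0..T} \<Longrightarrow> \<eta> t = level (cumul d) t - min (level (cumul d) t) 1"
proof -
  let ?I = "{0..T}" and ?D = "cumul d"
  from assms obtain z1 z2 z3 where d: "set_integrable lborel ?I d"
    and z: "set_borel_measurable lborel ?I z1" "set_borel_measurable lborel ?I z2" "set_borel_measurable lborel ?I z3"
    and \<rho>: "\<And>t. t \<in> ?I \<Longrightarrow> \<rho> t = min r0 1 * (1 - cdf F t)
             + (LINT u:{0..t}|lborel. z1 u * (1 - cdf G (t - u)) * lam u)
             + (LINT u:{0..t}|lborel. z2 u * (1 - cdf G (t - u)) * d u)"
    and \<eta>: "\<And>t. t \<in> ?I \<Longrightarrow> \<eta> t = max (r0 - 1) 0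
             + (LINT u:{0..t}|lborel. (1 - z1 u) * z3 u * lam u)
             - (LINT u:{0..t}|lborel. z2 u * d u)"
    and D: "\<And>t. t \<in> ?I \<Longrightarrow> (LINT u:{0..t}|lborel. d u) = min r0 1 * cdf F t
             + (LINT u:{0..t}|lborel. z1 u * cdf G (t - u) * lam u)
             + (LINT u:{0..t}|lborel. z2 u * cdf G (t - u) * d u)"
    and ae: "AE t\<in>?I in lborel.
           of_bool (\<rho> t < 1) \<le> z1 t \<and> z1 t \<le> 1 \<and>
           of_bool (\<eta> t > 0) \<le> z2 t \<and> z2 t \<le> 1 \<and>
           of_bool (\<eta> t < \<beta>) \<le> z3 t \<and> z3 t \<le> 1 \<and>
           0 \<le> \<rho> t \<and> \<rho> t \<le> 1 \<and> 0 \<le> \<eta> t \<and> \<eta> t \<le> \<beta> \<and> \<eta> t * (1 - \<rho> t) = 0"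
    unfolding fluid_solution_def by (elim conjE exE) blast
  show "set_integrable lborel ?I d" by (rule d)
  have z01: "0 \<le> z \<and> z \<le> 1" if "of_bool P \<le> z" "z \<le> (1::real)" for P z using that by (cases P) auto
  have bd: "AE t\<in>?I in lborel. \<bar>z1 t\<bar> \<le> 1" "AE t\<in>?I in lborel. \<bar>z2 t\<bar> \<le> 1"
     "AE t\<in>?I in lborel. \<bar>(1 - z1 t) * z3 t\<bar> \<le> 1" "AE t\<in>?I in lborel. \<bar>(1 - z1 t) * (1 - z3 t)\<bar> \<le> 1"
    using ae
    by (eventually_elim, use z01 in \<open>force simp: abs_mult intro!: mult_le_one\<close>)+
  have zm: "set_borel_measurable lborel ?I (\<lambda>t. (1 - z1 t) * z3 t)" "set_borel_measurable lborel ?I (\<lambda>t. (1 - z1 t) * (1 - z3 t))"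
  proof -
    have [measurable]: "(\<lambda>t. indicat_real ?I t * z1 t) \<in> borel_measurable borel"
       "(\<lambda>t. indicat_real ?I t * z3 t) \<in> borel_measurable borel"
      using z by (auto simp: set_borel_measurable_def)
    have "(\<lambda>t. indicat_real ?I t *\<^sub>R ((1 - z1 t) * z3 t)) =
        (\<lambda>t. (1 - indicat_real ?I t * z1 t) * (indicat_real ?I t * z3 t))"
      "(\<lambda>t. indicat_real ?I t *\<^sub>R ((1 - z1 t) * (1 - z3 t))) =
        (\<lambda>t. indicat_real ?I t * ((1 - indicat_real ?I t * z1 t) * (1 - indicat_real ?I t * z3 t)))"
      by (auto simp: indicator_def)
    then show "set_borel_measurable lborel ?I (\<lambda>t. (1 - z1 t) * z3 t)" "set_borel_measurable lborel ?I (\<lambda>t. (1 - z1 t) * (1 - z3 t))"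
      unfolding set_borel_measurable_def by simp_all
  qed
  let ?a = "\<lambda>u. z1 u * lam u" and ?b = "\<lambda>u. z2 u * d u" and ?m = "\<lambda>u. (1 - z1 u) * z3 u * lam u"
    and ?l = "\<lambda>u. (1 - z1 u) * (1 - z3 u) * lam u"
  have a: "set_integrable lborel ?I ?a" by (rule set_integrable_mult_bounded[OF lam(1) z(1) _ bd(1)]) simp
  have b: "set_integrable lborel ?I ?b" by (rule set_integrable_mult_bounded[OF d z(2) _ bd(2)]) simp
  have m: "set_integrable lborel ?I ?m" by (rule set_integrable_mult_bounded[OF lam(1) zm(1) _ bd(3)]) simp
  have l: "set_integrable lborel ?I ?l" by (rule set_integrable_mult_bounded[OF lam(1) zm(2) _ bd(4)]) simp
  have D': "?D t = min r0 1 * cumul f t + (conv g (cumul ?a) t + conv g (cumul ?b) t)" if t: "t \<in> ?I" for t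
    using D[OF t] service_cdf[OF a t] service_cdf[OF b t] F_cdf(1)[OF t] by (simp add: cumul_def[of d])
  have \<rho>': "\<rho> t = min r0 1 + cumul ?a t + cumul ?b t - ?D t" if t: "t \<in> ?I" for t
    using \<rho>[OF t] service_tail[OF a t] service_tail[OF b t] F_cdf(1)[OF t] D'[OF t] by (simp add: algebra_simps)
  have \<eta>': "\<eta> t = max (r0 - 1) 0 + cumul ?m t - cumul ?b t" if t: "t \<in> ?I" for t
    using \<eta>[OF t] by (simp add: cumul_def)
  have lam_split: "cumul lam t = cumul ?a t + cumul ?m t + cumul ?l t" if t: "t \<in> ?I" for t
  proof -
    have "cumul lam t = cumul (\<lambda>u. ?a u + ?m u + ?l u) t"
      by (rule arg_cong[where f = "\<lambda>h. cumul h t"]) (auto simp: algebra_simps)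
    also have "\<dots> = cumul (\<lambda>u. ?a u + ?m u) t + cumul ?l t"
      using a m l t by (intro cumul_add[of T]) auto
    also have "cumul (\<lambda>u. ?a u + ?m u) t = cumul ?a t + cumul ?m t"
      using a m t by (intro cumul_add[of T]) auto
    finally show ?thesis .
  qed
  \<comment> \<open>Transfers from buffer to servers, the \<open>z2\<close> integrals, cancel in the
    sum. Of the arrivals only the lost part \<open>?l\<close> is left to subtract.\<close>
  have x: "\<rho> t + \<eta> t = netput ?D t - cumul ?l t" if t: "t \<in> ?I" for t
    using \<rho>'[OF t] \<eta>'[OF t] lam_split[OF t] by (simp add: netput_def min_def max_def)
  have cont\<rho>: "continuous_on ?I \<rho>"
    by (rule continuous_on_eq[OF _ \<rho>'[symmetric]]) (intro continuous_intros continuous_on_cumul a b d)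
  have cont\<eta>: "continuous_on ?I \<eta>"
    by (rule continuous_on_eq[OF _ \<eta>'[symmetric]]) (intro continuous_intros continuous_on_cumul m b d)
  have le1: "\<rho> t \<le> 1" if "t \<in> ?I" for t
    by (rule le_on_Icc_of_AE_le[OF cont\<rho> continuous_on_const T _ that]) (use ae in eventually_elim, auto)
  have ge0: "0 \<le> \<eta> t" if "t \<in> ?I" for t
    by (rule le_on_Icc_of_AE_le[OF continuous_on_const cont\<eta> T _ that]) (use ae in eventually_elim, auto)
  have le\<beta>: "\<eta> t \<le> \<beta>" if "t \<in> ?I" for t
    by (rule le_on_Icc_of_AE_le[OF cont\<eta> continuous_on_const T _ that]) (use ae in eventually_elim, auto)
  \<comment> \<open>One inequality is enough, as both factors are already known to be nonnegative at
    every time.\<close>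
  have "\<eta> t * (1 - \<rho> t) \<le> 0" if "t \<in> ?I" for t
    by (rule le_on_Icc_of_AE_le[OF _ continuous_on_const T _ that])
       (intro continuous_intros cont\<eta> cont\<rho>, use ae in eventually_elim, auto)
  then have compl: "\<eta> t = 0 \<or> \<rho> t = 1" if "t \<in> ?I" for t
    using mult_nonneg_nonneg[of "\<eta> t" "1 - \<rho> t"] le1[OF that] ge0[OF that] that
    by (metis antisym diff_ge_0_iff_ge mult_eq_0_iff right_minus_eq)
  have contD: "continuous_on ?I ?D" by (rule continuous_on_cumul[OF d])
  have reg: "cumul ?l t = regulator c (netput ?D) t" if t: "t \<in> ?I" for t
  proof (rule regulator_unique[OF continuous_on_netput[OF contD] l _ _ _ t])
    show "AE u\<in>?I in lborel. 0 \<le> ?l u"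
      using ae by eventually_elim (use lam(2) in auto)
    show "netput ?D s - cumul ?l s \<le> c" if s: "s \<in> ?I" for s
      using x[OF s] le1[OF s] le\<beta>[OF s] c_eq by simp
    show "AE u\<in>?I in lborel. netput ?D u - cumul ?l u < c \<longrightarrow> ?l u = 0"
      using ae
    proof eventually_elim
      case (elim u)
      show ?case
      proof (intro impI)
        assume u: "u \<in> ?I" "netput ?D u - cumul ?l u < c"
        \<comment> \<open>Spare room is in the servers or in the buffer. In the first case
          \<open>z1 u = 1\<close>, in the second \<open>z3 u = 1\<close>; either way the loss rate
          vanishes.\<close>
        then have "\<rho> u < 1 \<or> \<eta> u < \<beta>" using x[OF u(1)] c_eq by auto
        then show "?l u = 0" using elim u(1) by auto
      qed
    qed
  qed
  have lev: "\<rho> t + \<eta> t = level ?D t" if t: "t \<in> ?I" for t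
    using x[OF t] reg[OF t] by (simp add: level_def)
  show \<rho>_eq: "\<rho> t = min (level ?D t) 1" if t: "t \<in> ?I" for t
    using lev[OF t] compl[OF t] le1[OF t] ge0[OF t] by auto
  show "\<eta> t = level ?D t - min (level ?D t) 1" if t: "t \<in> ?I" for t
    using lev[OF t] \<rho>_eq[OF t] by simp
  show "departures ?D t = ?D t" if t: "t \<in> ?I" for t
  proof -
    have "conv g (entered ?D) t = conv g (cumul ?a) t + conv g (cumul ?b) t"
    proof (rule conv_cumul_add[OF a b _ t])
      show "entered ?D v = cumul ?a v + cumul ?b v" if v: "v \<in> ?I" for v
        using \<rho>_eq[OF v] \<rho>'[OF v] by (simp add: entered_def)
    qed
    with D'[OF t] show ?thesis by (simp add: departures_def)
  qed
qed

lemma fluid_solution_exists: "\<exists>\<rho> \<eta> d. fluid_solution T lam G F \<beta> r0 \<rho> \<eta> d"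
proof -
  let ?I = "{0..T}"
  have T0: "0 \<le> T" using T by simp
  obtain D where D: "continuous_on ?I D" "mono_on ?I D" "D 0 = 0"
    and fp: "\<And>t. t \<in> ?I \<Longrightarrow> departures D t = D t"
    using fixpoint_exists by blast
  have A_T: "0 \<le> entered D T"
    using mono_onD[OF entered_mono[OF D(1,2)], of 0 T] entered_0[OF D(1,3)] T by simp
  let ?h = "\<lambda>u. min r0 1 * max 0 (f u) + C * entered D T"
  have h: "set_integrable lborel ?I ?h"
    by (intro set_integral_add(1) set_integrable_mult_right set_integrable_pos_part f(1)
        borel_integrable_atLeastAtMost' continuous_intros)
  obtain d where d: "d \<in> borel_measurable borel" "set_integrable lborel ?I d" "\<And>u. 0 \<le> d u"
    and D_d: "\<And>t. t \<in> ?I \<Longrightarrow> D t = cumul d t"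
  proof (rule density_exists[OF h _ T0 D(2,3)])
    show "0 \<le> ?h u" for u using r0 g(4) A_T by simp
    show "D t - D s \<le> cumul ?h t - cumul ?h s" if "0 \<le> s" "s \<le> t" "t \<le> T" for s t
      using departures_increment[OF D that] fp[of s] fp[of t] that by simp
  qed blast
  let ?y = "netput D" and ?L = "regulator c (netput D)" and ?x = "level D"
  note y = continuous_on_netput[OF D(1)]
  have y0: "?y 0 \<le> c" using r0 D(3) by (simp add: netput_def)
  \<comment> \<open>\<open>lam\<close> may be negative to the left of 0, whereas
    \<open>density_exists\<close> asks for a function that is nonnegative everywhere.\<close>
  have lam': "set_integrable lborel ?I (\<lambda>u. max 0 (lam u))" by (rule set_integrable_pos_part[OF lam(1)])
  have lam'_eq: "cumul (\<lambda>u. max 0 (lam u)) t = cumul lam t" if "t \<in> ?I" for t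
    by (rule cumul_cong_AE[OF lam' lam(1)]) (use lam(2) that in auto)
  obtain l where l: "l \<in> borel_measurable borel" "set_integrable lborel ?I l" "\<And>u. 0 \<le> l u"
    and l_le: "AE u\<in>?I in lborel. l u \<le> max 0 (lam u)"
    and L_l: "\<And>t. t \<in> ?I \<Longrightarrow> ?L t = cumul l t"
  proof (rule density_exists[OF lam' _ T0])
    show "mono_on ?I ?L" by (rule mono_onI) (use regulator_mono[OF y] in auto)
    show "?L 0 = 0" by (rule regulator_0[of "netput D", OF y0])
    show "?L t - ?L s \<le> cumul (\<lambda>u. max 0 (lam u)) t - cumul (\<lambda>u. max 0 (lam u)) s"
      if st: "0 \<le> s" "s \<le> t" "t \<le> T" for s t
    proof -
      have \<Lambda>: "cumul lam u \<le> cumul lam v" if "0 \<le> u" "u \<le> v" "v \<le> T" for u v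
        using cumul_lam_mono that by blast
      \<comment> \<open>Losses cannot exceed arrivals: if the regulator grows, its increment is at
        most \<open>?y u - ?y s\<close> for some \<open>u\<close> in between, and departures only
        lower \<open>?y\<close>.\<close>
      have "?L t - ?L s \<le> cumul lam t - cumul lam s"
      proof (cases "?L s < ?L t")
        case True
        then obtain u where u: "u \<in> {s<..t}" "?L t = ?y u - c" using regulator_increase[OF y st] by blast
        have "?y s - c \<le> ?L s" using regulator_ge[OF y, of s s c] st by auto
        moreover have "D s \<le> D u" using mono_onD[OF D(2), of s u] u st by auto
        ultimately show ?thesis using u \<Lambda>[of u t] st by (auto simp: netput_def)
      next
        case False
        then show ?thesis using \<Lambda>[OF st] by simp
      qed
      then show ?thesis using lam'_eq[of s] lam'_eq[of t] st by simp
    qed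
  qed auto
  have flat: "AE u\<in>?I in lborel. ?x u < c \<longrightarrow> l u = 0"
    using regulator_density_flat[OF y l(2,3) L_l T0] by (simp add: level_def)
  \<comment> \<open>This is the density of \<open>1 - ?x\<close>. Reversing the sign turns
    \<open>min ?x 1\<close> into a positive part.\<close>
  let ?\<xi> = "\<lambda>u. d u + l u - lam u"
  have \<xi>: "set_integrable lborel ?I ?\<xi>" using d l lam by auto
  have x_eq: "1 - ?x t = (1 - r0) + cumul ?\<xi> t" if t: "t \<in> ?I" for t
  proof -
    have "cumul ?\<xi> t = cumul (\<lambda>u. d u + l u) t - cumul lam t"
      using d l lam t by (intro cumul_diff_fun[of T]) auto
    also have "cumul (\<lambda>u. d u + l u) t = cumul d t + cumul l t"
      using d l t by (intro cumul_add[of T]) auto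
    finally show ?thesis using D_d[OF t] L_l[OF t] by (simp add: level_def netput_def)
  qed
  \<comment> \<open>At level exactly 1 the constraints leave \<open>z1\<close> and \<open>z2\<close>
    free in [0,1]. The values 0 and 1 taken there are those dictated by the chain rule, which gives
    no weight to \<open>?x u = 1\<close>.\<close>
  define z1 where "z1 u = (of_bool (?x u < 1) :: real)" for u
  define z2 where "z2 u = 1 - z1 u" for u
  \<comment> \<open>chosen such that \<open>(1 - z3) lam\<close> is the loss density \<open>l\<close>\<close>
  define z3 where "z3 u = (if 0 < lam u then 1 - l u / lam u else 1)" for u
  have z1_01: "0 \<le> z1 u" "z1 u \<le> 1" and z2_01: "0 \<le> z2 u" "z2 u \<le> 1" for u
    by (auto simp: z1_def z2_def)
  have z1m: "set_borel_measurable lborel ?I z1"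
    unfolding z1_def[abs_def]
    by (intro set_borel_measurable_of_bool_less set_borel_measurable_continuous_on_Icc continuous_on_level D(1)) simp
  have z2m: "set_borel_measurable lborel ?I z2"
    unfolding z2_def[abs_def] using z1m unfolding set_borel_measurable_def
    by (simp add: right_diff_distrib)
  have z3m: "set_borel_measurable lborel ?I z3"
  proof -
    have [measurable]: "(\<lambda>u. indicat_real ?I u * lam u) \<in> borel_measurable borel"
      using lam(1) by (auto simp: set_integrable_def)
    have [measurable]: "l \<in> borel_measurable borel" by (rule l(1))
    have "(\<lambda>u. indicat_real ?I u *\<^sub>R z3 u) =
      (\<lambda>u. indicat_real ?I u * (if 0 < indicat_real ?I u * lam u then 1 - l u / (indicat_real ?I u * lam u) else 1))"
      by (auto simp: indicator_def z3_def)
    then show ?thesis unfolding set_borel_measurable_def by simp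
  qed
  let ?a = "\<lambda>u. z1 u * lam u" and ?b = "\<lambda>u. z2 u * d u" and ?m = "\<lambda>u. (1 - z1 u) * z3 u * lam u"
  have a: "set_integrable lborel ?I ?a"
    by (rule set_integrable_mult_bounded[OF lam(1) z1m, where C = 1]) (use z1_01 in auto)
  have b: "set_integrable lborel ?I ?b"
    by (rule set_integrable_mult_bounded[OF d(2) z2m, where C = 1]) (use z2_01 in auto)
  have lal: "set_integrable lborel ?I (\<lambda>u. lam u - l u - ?a u)" using lam l a by auto
  have z3_lam: "AE u\<in>?I in lborel. z3 u * lam u = lam u - l u"
    using l_le
  proof eventually_elim
    case (elim u)
    show ?case
    proof
      assume u: "u \<in> ?I"
      then show "z3 u * lam u = lam u - l u"
        using elim l(3)[of u] lam(2)[of u] by (cases "0 < lam u") (auto simp: z3_def field_simps)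
    qed
  qed
  \<comment> \<open>Since \<open>1 \<le> c\<close>, a level below 1 is below \<open>c\<close>, so
    nothing is lost while a server is idle.\<close>
  have z1_l: "AE u\<in>?I in lborel. z1 u * l u = 0"
    using flat by eventually_elim (use c in \<open>auto simp: z1_def\<close>)
  have m_eq: "AE u\<in>?I in lborel. ?m u = lam u - l u - ?a u"
    using z3_lam z1_l
  proof eventually_elim
    case (elim u)
    show ?case
    proof
      assume "u \<in> ?I"
      with elim have *: "z3 u * lam u = lam u - l u" "z1 u * l u = 0" by auto
      have "?m u = (z3 u * lam u) - z1 u * (z3 u * lam u)" by (simp add: algebra_simps)
      also have "\<dots> = lam u - l u - ?a u" unfolding *(1) using *(2) by (simp add: algebra_simps)
      finally show "?m u = lam u - l u - ?a u" .
    qed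
  qed
  have m: "set_integrable lborel ?I ?m"
  proof -
    have z3b: "AE u\<in>?I in lborel. \<bar>(1 - z1 u) * z3 u\<bar> \<le> 1"
      using l_le
    proof eventually_elim
      case (elim u)
      show ?case
      proof
        assume u: "u \<in> ?I"
        then have "0 \<le> z3 u" "z3 u \<le> 1" using elim l(3)[of u] lam(2)[of u] by (auto simp: z3_def)
        then show "\<bar>(1 - z1 u) * z3 u\<bar> \<le> 1"
          using z1_01[of u] by (simp add: abs_mult mult_le_one)
      qed
    qed
    have "set_borel_measurable lborel ?I (\<lambda>u. (1 - z1 u) * z3 u)"
    proof -
      have [measurable]: "(\<lambda>t. indicat_real ?I t * z1 t) \<in> borel_measurable borel"
         "(\<lambda>t. indicat_real ?I t * z3 t) \<in> borel_measurable borel"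
        using z1m z3m by (auto simp: set_borel_measurable_def)
      have "(\<lambda>t. indicat_real ?I t *\<^sub>R ((1 - z1 t) * z3 t)) =
          (\<lambda>t. (1 - indicat_real ?I t * z1 t) * (indicat_real ?I t * z3 t))"
        by (auto simp: indicator_def)
      then show ?thesis unfolding set_borel_measurable_def by simp
    qed
    from set_integrable_mult_bounded[OF lam(1) this _ z3b] show ?thesis by simp
  qed
  have A: "entered D t = cumul ?a t + cumul ?b t" if t: "t \<in> ?I" for t
  proof -
    \<comment> \<open>The left side is \<open>1 - min (?x t) 1\<close>. As \<open>z1 * l\<close>
      vanishes almost everywhere, the density on the right equals \<open>d\<close> minus the two
      entry rates, which rearranges to the claim.\<close>
    have "max 0 (1 - ?x t) = max 0 (1 - ?x 0) + cumul (\<lambda>u. of_bool (0 < 1 - ?x u) * ?\<xi> u) t"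
    proof (rule chain_rule_pos_part[OF \<xi> _ t])
      show "1 - ?x s = 1 - ?x 0 + cumul ?\<xi> s" if "s \<in> ?I" for s
        using x_eq[OF that] level_0[OF D(1,3)] by simp
    qed
    also have "cumul (\<lambda>u. of_bool (0 < 1 - ?x u) * ?\<xi> u) t = cumul (\<lambda>u. z1 u * ?\<xi> u) t"
      by (simp add: z1_def)
    also have "\<dots> = cumul (\<lambda>u. d u - (?a u + ?b u)) t"
    proof (rule cumul_cong_AE)
      show "set_integrable lborel ?I (\<lambda>u. z1 u * ?\<xi> u)"
        by (rule set_integrable_mult_bounded[OF \<xi> z1m, where C = 1]) (use z1_01 in auto)
      show "set_integrable lborel ?I (\<lambda>u. d u - (?a u + ?b u))" using d a b by auto
      show "AE u\<in>?I in lborel. z1 u * ?\<xi> u = d u - (?a u + ?b u)"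
        using z1_l by eventually_elim (auto simp: z2_def algebra_simps)
      show "t \<le> T" using t by simp
    qed
    also have "\<dots> = cumul d t - cumul (\<lambda>u. ?a u + ?b u) t"
      using d a b t by (intro cumul_diff_fun[of T]) auto
    also have "cumul (\<lambda>u. ?a u + ?b u) t = cumul ?a t + cumul ?b t"
      using a b t by (intro cumul_add[of T]) auto
    finally show ?thesis
      using D_d[OF t] level_0[OF D(1,3)] by (simp add: entered_def min_def max_def split: if_splits)
  qed
  have D_eq: "D t = min r0 1 * cdf F t + (conv g (cumul ?a) t + conv g (cumul ?b) t)" if t: "t \<in> ?I" for t
    using fp[OF t] conv_cumul_add[OF a b A t] F_cdf(1)[OF t] by (simp add: departures_def)
  define \<rho> where "\<rho> t = min (?x t) 1" for t
  define \<eta> where "\<eta> t = ?x t - \<rho> t" for t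
  have \<rho>_eq: "\<rho> t = min r0 1 * (1 - cdf F t)
             + (LINT u:{0..t}|lborel. z1 u * (1 - cdf G (t - u)) * lam u)
             + (LINT u:{0..t}|lborel. z2 u * (1 - cdf G (t - u)) * d u)" if t: "t \<in> ?I" for t
    using service_tail[OF a t] service_tail[OF b t] D_eq[OF t] A[OF t]
    by (simp add: \<rho>_def entered_def algebra_simps)
  have \<eta>_eq: "\<eta> t = max (r0 - 1) 0
             + (LINT u:{0..t}|lborel. (1 - z1 u) * z3 u * lam u)
             - (LINT u:{0..t}|lborel. z2 u * d u)" if t: "t \<in> ?I" for t
  proof -
    have "cumul ?m t = cumul (\<lambda>u. lam u - l u - ?a u) t"
      by (rule cumul_cong_AE[OF m lal m_eq]) (use t in simp)
    also have "\<dots> = cumul (\<lambda>u. lam u - l u) t - cumul ?a t"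
      using lam l a t by (intro cumul_diff_fun[of T]) auto
    also have "cumul (\<lambda>u. lam u - l u) t = cumul lam t - cumul l t"
      using lam l t by (intro cumul_diff_fun[of T]) auto
    finally have "\<eta> t = max (r0 - 1) 0 + cumul ?m t - cumul ?b t"
      using A[OF t] L_l[OF t] by (simp add: \<eta>_def \<rho>_def entered_def level_def netput_def)
    then show ?thesis by (simp add: cumul_def)
  qed
  have D_int: "(LINT u:{0..t}|lborel. d u) = min r0 1 * cdf F t
             + (LINT u:{0..t}|lborel. z1 u * cdf G (t - u) * lam u)
             + (LINT u:{0..t}|lborel. z2 u * cdf G (t - u) * d u)" if t: "t \<in> ?I" for t
    using D_eq[OF t] D_d[OF t] service_cdf[OF a t] service_cdf[OF b t] by (simp add: cumul_def[of d])
  \<comment> \<open>\<open>\<rho> = min ?x 1\<close> gives no lower bound by itself; it comes from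
    the service equation, all of whose terms are nonnegative.\<close>
  have \<rho>_nonneg: "0 \<le> \<rho> t" if t: "t \<in> ?I" for t
  proof -
    have "0 \<le> (LINT u:{0..t}|lborel. z1 u * (1 - cdf G (t - u)) * lam u)"
      unfolding set_lebesgue_integral_def using z1_01 G_cdf(2) lam(2)
      by (intro integral_nonneg_AE AE_I2) (auto simp: indicator_def)
    moreover have "0 \<le> (LINT u:{0..t}|lborel. z2 u * (1 - cdf G (t - u)) * d u)"
      unfolding set_lebesgue_integral_def using z2_01 G_cdf(2) d(3)
      by (intro integral_nonneg_AE AE_I2) (auto simp: indicator_def)
    moreover have "0 \<le> min r0 1 * (1 - cdf F t)" using r0 F_cdf(2) by simp
    ultimately show ?thesis using \<rho>_eq[OF t] by simp
  qed
  have ae: "AE t\<in>?I in lborel.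
           of_bool (\<rho> t < 1) \<le> z1 t \<and> z1 t \<le> 1 \<and>
           of_bool (\<eta> t > 0) \<le> z2 t \<and> z2 t \<le> 1 \<and>
           of_bool (\<eta> t < \<beta>) \<le> z3 t \<and> z3 t \<le> 1 \<and>
           0 \<le> \<rho> t \<and> \<rho> t \<le> 1 \<and>
           0 \<le> \<eta> t \<and> \<eta> t \<le> \<beta> \<and>
           \<eta> t * (1 - \<rho> t) = 0"
    using l_le flat
  proof eventually_elim
    case (elim u)
    show ?case
    proof
      assume u: "u \<in> ?I"
      have x_le: "?x u \<le> c" by (rule level_le[OF D(1) u])
      have "of_bool (\<eta> u < \<beta>) \<le> z3 u"
      proof (cases "\<eta> u < \<beta>")
        case True
        then have "?x u < c" using c_eq by (auto simp: \<eta>_def \<rho>_def min_def split: if_splits)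
        then show ?thesis using elim u by (simp add: z3_def)
      next
        case False
        then show ?thesis using elim u l(3)[of u] by (auto simp: z3_def)
      qed
      moreover have "z3 u \<le> 1" using l(3)[of u] by (simp add: z3_def)
      moreover have "0 \<le> \<eta> u" "\<eta> u \<le> \<beta>" "\<rho> u \<le> 1" "\<eta> u * (1 - \<rho> u) = 0"
        using x_le c c_eq by (auto simp: \<eta>_def \<rho>_def min_def)
      moreover have "of_bool (\<rho> u < 1) \<le> z1 u" "of_bool (\<eta> u > 0) \<le> z2 u"
        by (auto simp: \<eta>_def \<rho>_def z1_def z2_def min_def)
      ultimately show "of_bool (\<rho> u < 1) \<le> z1 u \<and> z1 u \<le> 1 \<and>
           of_bool (\<eta> u > 0) \<le> z2 u \<and> z2 u \<le> 1 \<and>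
           of_bool (\<eta> u < \<beta>) \<le> z3 u \<and> z3 u \<le> 1 \<and>
           0 \<le> \<rho> u \<and> \<rho> u \<le> 1 \<and> 0 \<le> \<eta> u \<and> \<eta> u \<le> \<beta> \<and> \<eta> u * (1 - \<rho> u) = 0"
        using z1_01[of u] z2_01[of u] \<rho>_nonneg[OF u] by simp
    qed
  qed
  have "fluid_solution T lam G F \<beta> r0 \<rho> \<eta> d"
    unfolding fluid_solution_def
    by (intro conjI exI[of _ z1] exI[of _ z2] exI[of _ z3] ballI d(2) z1m z2m z3m \<rho>_eq \<eta>_eq D_int ae)
  then show ?thesis by blast
qed

lemma fluid_solution_unique:
  assumes s: "fluid_solution T lam G F \<beta> r0 \<rho> \<eta> d" and s': "fluid_solution T lam G F \<beta> r0 \<rho>' \<eta>' d'"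
  shows "\<And>t. t \<in> {0..T} \<Longrightarrow> \<rho>' t = \<rho> t" "\<And>t. t \<in> {0..T} \<Longrightarrow> \<eta>' t = \<eta> t"
    and "AE t\<in>{0..T} in lborel. d' t = d t"
proof -
  note S = fluid_solution_imp_fixpoint[OF s] and S' = fluid_solution_imp_fixpoint[OF s']
  have eq: "cumul d' t = cumul d t" if "t \<in> {0..T}" for t
    by (rule fixpoint_unique[OF continuous_on_cumul[OF S'(1)] continuous_on_cumul[OF S(1)] S'(2) S(2) that])
  have lev: "level (cumul d') t = level (cumul d) t" if t: "t \<in> {0..T}" for t
  proof -
    have net: "netput (cumul d') s = netput (cumul d) s" if "s \<in> {0..t}" for s
      using eq[of s] that t by (simp add: netput_def)
    then have "regulator c (netput (cumul d')) t = regulator c (netput (cumul d)) t"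
      unfolding regulator_def by (intro SUP_cong) auto
    then show ?thesis using net[of t] t by (simp add: level_def)
  qed
  show "\<rho>' t = \<rho> t" "\<eta>' t = \<eta> t" if "t \<in> {0..T}" for t
    using S(3,4)[OF that] S'(3,4)[OF that] lev[OF that] by simp_all
  show "AE t\<in>{0..T} in lborel. d' t = d t"
    by (rule AE_eq_of_cumul_eq[OF S'(1) S(1) _ eq]) (use T in simp)
qed

end

text \<open>\<open>cdf\<close> integrates the density from minus infinity and \<open>cumul\<close>
  from 0; they agree because \<open>g\<close> vanishes almost everywhere on the negative
  axis.\<close>

lemma cdf_density_eq_cumul:
  assumes G: "real_distribution G" "AE x in G. 0 \<le> x"
    and g: "g \<in> borel_measurable borel" "\<And>x. 0 \<le> g x" "G = density lborel (\<lambda>x. ennreal (g x))"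
    and v: "0 \<le> v"
  shows "cdf G v = cumul g v"
proof -
  interpret real_distribution G by (rule G(1))
  have neg: "AE x in lborel. x < 0 \<longrightarrow> g x = 0"
  proof -
    have "AE x in lborel. 0 < ennreal (g x) \<longrightarrow> 0 \<le> x"
      using G(2) g(1) unfolding g(3) by (subst (asm) AE_density) auto
    then show ?thesis by eventually_elim (use g(2) in \<open>force simp: order_less_le\<close>)
  qed
  have "ennreal (cdf G v) = emeasure G {..v}"
    by (simp add: cdf_def emeasure_eq_measure)
  also have "\<dots> = (\<integral>\<^sup>+x. ennreal (g x) * indicator {..v} x \<partial>lborel)"
    using g(1) unfolding g(3) by (subst emeasure_density) auto
  also have "\<dots> = (\<integral>\<^sup>+x. ennreal (indicator {0..v} x *\<^sub>R g x) \<partial>lborel)"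
    by (rule nn_integral_cong_AE) (use neg in eventually_elim, auto simp: indicator_def)
  finally have nn: "(\<integral>\<^sup>+x. ennreal (indicator {0..v} x *\<^sub>R g x) \<partial>lborel) = ennreal (cdf G v)" by simp
  show ?thesis
    unfolding cumul_def set_lebesgue_integral_def
    by (subst integral_eq_nn_integral) (use g(1,2) nn cdf_nonneg in auto)
qed

theorem theorem4p1:
  fixes T \<beta> r0 c\<^sub>g :: real
    and lam g f :: "real \<Rightarrow> real"
    and G F :: "real measure"
  assumes T: "T > 0"
    and lam_nonneg: "\<And>t. t \<ge> 0 \<Longrightarrow> lam t \<ge> 0"
    and lam_locally_integrable: "\<And>t. t \<ge> 0 \<Longrightarrow> set_integrable lborel {0..t} lam"
    and G: "real_distribution G" "AE x in G. 0 \<le> x"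
    and g: "g \<in> borel_measurable borel" "\<And>x. 0 \<le> g x" "\<And>x. g x \<le> c\<^sub>g" "c\<^sub>g > 0"
    and G_density: "G = density lborel (\<lambda>x. ennreal (g x))"
    and F: "real_distribution F" "AE x in F. 0 \<le> x"
    and F_density: "set_integrable lborel {0..T} f"
      "\<And>t. t \<in> {0..T} \<Longrightarrow> cdf F t = (LINT u:{0..t}|lborel. f u)"
    and \<beta>: "\<beta> \<ge> 0"
    and r0: "r0 > 0" "r0 \<le> 1 + \<beta>"
  shows "\<exists>\<rho> \<eta> d. fluid_solution T lam G F \<beta> r0 \<rho> \<eta> d \<and>
           (\<forall>\<rho>' \<eta>' d'. fluid_solution T lam G F \<beta> r0 \<rho>' \<eta>' d' \<longrightarrow>
              (\<forall>t\<in>{0..T}. \<rho>' t = \<rho> t \<and> \<eta>' t = \<eta> t) \<and>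
              (AE t\<in>{0..T} in lborel. d' t = d t))"
proof -
  interpret G: real_distribution G by (rule G(1))
  interpret F: real_distribution F by (rule F(1))
  have F_cumul: "cdf F t = cumul f t" if "t \<in> {0..T}" for t
    using F_density(2)[OF that] by (simp add: cumul_def)
  interpret fluid_queue_distributions T r0 "1 + \<beta>" c\<^sub>g lam g f G F \<beta>
  proof
    show "mono_on {0..T} (cumul f)"
      using F.cdf_nondecreasing by (auto intro!: mono_onI simp flip: F_cumul)
    show "cdf G v = cumul g v" if "v \<in> {0..T}" for v
      using cdf_density_eq_cumul[OF G g(1,2) G_density] that by simp
  qed (use T lam_nonneg lam_locally_integrable g F_density(1) F_cumul r0 \<beta> G.cdf_bounded_prob F.cdf_bounded_prob in auto)
  obtain \<rho> \<eta> d where sol: "fluid_solution T lam G F \<beta> r0 \<rho> \<eta> d"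
    using fluid_solution_exists by blast
  show ?thesis
    by (intro exI[of _ \<rho>] exI[of _ \<eta>] exI[of _ d] conjI allI impI ballI sol fluid_solution_unique[OF sol])
qed

end
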